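(* Let $\mathcal{A}$ be a dual Banach algebra. If $\mathcal{A}$ is Connes amenable, then $\mathcal{A}$ is strong pseudo-Connes amenable.
   Context: A Banach algebra $\mathcal{A}$ is a dual Banach algebra if there is a closed submodule $\mathcal{A}_*$ of the dual bimodule $\mathcal{A}^*$ with $\mathcal{A}=(\mathcal{A}_* )^*$; the $wk^*$-topology on $\mathcal{A}$ is $\sigma(\mathcal{A},\mathcal{A}_* )$. For a Banach $\mathcal{A}$-bimodule $E$, $\sigma wc(E)$ is the closed submodule of all $x\in E$ such that the maps $\mathcal{A}\to E$, $a\mapsto a\cdot x$ and $a\mapsto x\cdot a$, are $wk^*$-$wk$-continuous. The projective tensor product $\mathcal{A}\hat\otimes\mathcal{A}$ is an $\mathcal{A}$-bimodule via $a\cdot(b\otimes c)=ab\otimes c$, $(b\otimes c)\cdot a=b\otimes ca$; duals carry the dual module actions. Write $\sigma wc(\mathcal{A}\hat\otimes\mathcal{A})^*$ for $\sigma wc((\mathcal{A}\hat\otimes\mathcal{A})^* )$. Let $\pi:\mathcal{A}\hat\otimes\mathcal{A}\to\mathcal{A}$, $\pi(a\otimes b)=ab$. Then $\pi^*$ maps $\mathcal{A}_*$ into $\sigma wc(\mathcal{A}\hat\otimes\mathcal{A})^*$, and $\pi_{\sigma wc}:(\sigma wc(\mathcal{A}\hat\otimes\mathcal{A})^* )^*\to\mathcal{A}$ denotes the adjoint of $\pi^*|_{\mathcal{A}_*}$; it is an $\mathcal{A}$-bimodule morphism. $\mathcal{A}$ is strong pseudo-Connes amenable if there is a (not necessarily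 bounded) net $(m_\alpha)$ in $(\sigma wc(\mathcal{A}\hat\otimes\mathcal{A})^* )^*$ such that for every $a\in\mathcal{A}$: (i) $a\cdot m_\alpha-m_\alpha\cdot a\to0$ in the $wk^*$-topology of $(\sigma wc(\mathcal{A}\hat\otimes\mathcal{A})^* )^*$; (ii) $a\,\pi_{\sigma wc}(m_\alpha)=\pi_{\sigma wc}(m_\alpha)\,a$ for all $\alpha$, and $a\,\pi_{\sigma wc}(m_\alpha)\to a$ in the $wk^*$-topology of $\mathcal{A}$. $\mathcal{A}$ is Connes amenable if it has a $\sigma wc$-virtual diagonal, i.e. an element $M\in(\sigma wc(\mathcal{A}\hat\otimes\mathcal{A})^* )^*$ with $a\cdot M=M\cdot a$ and $a\,\pi_{\sigma wc}(M)=a$ for every $a\in\mathcal{A}$. *)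

theory Defs
  imports "HOL-Analysis.Analysis" "HOL-Library.Poly_Mapping"
begin

section \<open>Complex normed spaces and Banach algebras\<close>

class scaleC =
  fixes scaleC :: "complex \<Rightarrow> 'a \<Rightarrow> 'a" (infixr \<open>*\<^sub>C\<close> 75)

class complex_vector = real_vector + scaleC +
  assumes scaleC_add_right: "c *\<^sub>C (x + y) = c *\<^sub>C x + c *\<^sub>C y"
    and scaleC_add_left: "(c + d) *\<^sub>C x = c *\<^sub>C x + d *\<^sub>C x"
    and scaleC_scaleC: "c *\<^sub>C d *\<^sub>C x = (c * d) *\<^sub>C x"
    and scaleC_of_real: "of_real r *\<^sub>C x = r *\<^sub>R x"

class complex_normed_vector = complex_vector + real_normed_vector +
  assumes norm_scaleC: "norm (c *\<^sub>C x) = cmod c * norm x"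

text \<open>Banach algebras are not assumed to be unital.\<close>

class complex_banach_algebra = complex_normed_vector + real_normed_algebra + banach +
  assumes scaleC_mult_left: "(c *\<^sub>C x) * y = c *\<^sub>C (x * y)"
    and scaleC_mult_right: "x * (c *\<^sub>C y) = c *\<^sub>C (x * y)"

instantiation complex :: complex_normed_vector
begin
definition scaleC_complex :: "complex \<Rightarrow> complex \<Rightarrow> complex" where
  "scaleC_complex c x = c * x"
instance
  by standard (auto simp: scaleC_complex_def algebra_simps norm_mult scaleR_conv_of_real)
end

lemma scaleC_one [simp]: "1 *\<^sub>C (x::'a::complex_vector) = x"
  using scaleC_of_real[of 1 x] by simp

lemma scaleC_zero_left [simp]: "0 *\<^sub>C (x::'a::complex_vector) = 0"
  using scaleC_of_real[of 0 x] by simp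

lemma scaleC_zero_right [simp]: "c *\<^sub>C (0::'a::complex_vector) = 0"
  using scaleC_add_right[of c 0 0] by simp

lemma scaleC_minus1: "(- 1) *\<^sub>C (x::'a::complex_vector) = - x"
  using scaleC_of_real[of "-1" x] by simp

lemma scaleC_minus_right: "c *\<^sub>C (- x) = - (c *\<^sub>C (x::'a::complex_vector))"
  by (metis add.right_inverse add_eq_0_iff scaleC_add_right scaleC_zero_right)

lemma scaleC_diff_right: "c *\<^sub>C (x - y) = c *\<^sub>C x - c *\<^sub>C (y::'a::complex_vector)"
  by (metis diff_conv_add_uminus scaleC_add_right scaleC_minus_right)

lemma scaleC_sum_right: "c *\<^sub>C sum f A = (\<Sum>i\<in>A. c *\<^sub>C (f i :: 'a::complex_vector))"
  by (induction A rule: infinite_finite_induct) (auto simp: scaleC_add_right)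

definition bounded_clinear :: "('a::complex_normed_vector \<Rightarrow> 'b::complex_normed_vector) \<Rightarrow> bool" where
  "bounded_clinear f \<longleftrightarrow> bounded_linear f \<and> (\<forall>c x. f (c *\<^sub>C x) = c *\<^sub>C f x)"

definition bounded_cbilinear ::
  "('a::complex_normed_vector \<Rightarrow> 'b::complex_normed_vector \<Rightarrow> 'c::complex_normed_vector) \<Rightarrow> bool" where
  "bounded_cbilinear f \<longleftrightarrow> bounded_bilinear f
     \<and> (\<forall>c x y. f (c *\<^sub>C x) y = c *\<^sub>C f x y) \<and> (\<forall>c x y. f x (c *\<^sub>C y) = c *\<^sub>C f x y)"

definition csubspace :: "'a::complex_vector set \<Rightarrow> bool" where
  "csubspace V \<longleftrightarrow> 0 \<in> V \<and> (\<forall>x\<in>V. \<forall>y\<in>V. x + y \<in> V) \<and> (\<forall>c. \<forall>x\<in>V. c *\<^sub>C x \<in> V)"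


section \<open>Dual spaces\<close>

typedef (overloaded) ('a::complex_normed_vector) cdual =
  "{f :: 'a \<Rightarrow>\<^sub>L complex. \<forall>c x. blinfun_apply f (c *\<^sub>C x) = c * blinfun_apply f x}"
  by (rule exI[of _ 0]) simp

setup_lifting type_definition_cdual

instantiation cdual :: (complex_normed_vector) complex_normed_vector
begin
lift_definition zero_cdual :: "'a cdual" is 0 by simp
lift_definition plus_cdual :: "'a cdual \<Rightarrow> 'a cdual \<Rightarrow> 'a cdual" is "(+)"
  by (simp add: blinfun.add_left distrib_left)
lift_definition minus_cdual :: "'a cdual \<Rightarrow> 'a cdual \<Rightarrow> 'a cdual" is "(-)"
  by (simp add: blinfun.diff_left right_diff_distrib)
lift_definition uminus_cdual :: "'a cdual \<Rightarrow> 'a cdual" is "uminus"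
  by (simp add: blinfun.minus_left)
lift_definition scaleR_cdual :: "real \<Rightarrow> 'a cdual \<Rightarrow> 'a cdual" is "scaleR"
  by (simp add: blinfun.scaleR_left)
lift_definition scaleC_cdual :: "complex \<Rightarrow> 'a cdual \<Rightarrow> 'a cdual"
  is "\<lambda>c f. blinfun_compose (Blinfun ((*) c)) f"
  by (simp add: bounded_linear_Blinfun_apply bounded_linear_mult_right)
lift_definition norm_cdual :: "'a cdual \<Rightarrow> real" is norm .
definition dist_cdual :: "'a cdual \<Rightarrow> 'a cdual \<Rightarrow> real" where
  "dist_cdual f g = norm (f - g)"
definition sgn_cdual :: "'a cdual \<Rightarrow> 'a cdual" where
  "sgn_cdual f = inverse (norm f) *\<^sub>R f"
definition uniformity_cdual :: "('a cdual \<times> 'a cdual) filter" where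
  "uniformity_cdual = (INF e\<in>{0<..}. principal {(x, y). dist x y < e})"
definition open_cdual :: "'a cdual set \<Rightarrow> bool" where
  "open_cdual U = (\<forall>x\<in>U. eventually (\<lambda>(x', y). x' = x \<longrightarrow> y \<in> U) uniformity)"
instance
proof
  fix f g h :: "'a cdual" and r s :: real and c d :: complex
  have mult: "blinfun_apply (Blinfun ((*) z)) w = z * w" for z w :: complex
    by (simp add: bounded_linear_Blinfun_apply bounded_linear_mult_right)
  show "f + g + h = f + (g + h)" by transfer simp
  show "f + g = g + f" by transfer simp
  show "0 + f = f" by transfer simp
  show "- f + f = 0" by transfer simp
  show "f - g = f + - g" by transfer simp
  show "r *\<^sub>R (f + g) = r *\<^sub>R f + r *\<^sub>R g" by transfer (rule scaleR_add_right)
  show "(r + s) *\<^sub>R f = r *\<^sub>R f + s *\<^sub>R f" by transfer (rule scaleR_add_left)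
  show "r *\<^sub>R s *\<^sub>R f = (r * s) *\<^sub>R f" by transfer simp
  show "1 *\<^sub>R f = f" by transfer simp
  show "c *\<^sub>C (f + g) = c *\<^sub>C f + c *\<^sub>C g"
    by transfer (auto intro!: blinfun_eqI simp: mult blinfun.bilinear_simps distrib_left)
  show "(c + d) *\<^sub>C f = c *\<^sub>C f + d *\<^sub>C f"
    by transfer (auto intro!: blinfun_eqI simp: mult blinfun.bilinear_simps distrib_right)
  show "c *\<^sub>C d *\<^sub>C f = (c * d) *\<^sub>C f"
    by transfer (auto intro!: blinfun_eqI simp: mult)
  show "of_real r *\<^sub>C f = r *\<^sub>R f"
    by transfer (auto intro!: blinfun_eqI simp: mult blinfun.bilinear_simps scaleR_conv_of_real)
  show "norm f = 0 \<longleftrightarrow> f = 0" by transfer simp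
  show "norm (f + g) \<le> norm f + norm g" by transfer (rule norm_triangle_ineq)
  show "norm (r *\<^sub>R f) = \<bar>r\<bar> * norm f" by transfer simp
  have le: "norm (c *\<^sub>C f) \<le> cmod c * norm f" for c and f :: "'a cdual"
  proof (transfer, rule norm_blinfun_bound)
    fix c :: complex and f :: "'a \<Rightarrow>\<^sub>L complex" and x
    show "0 \<le> cmod c * norm f" by simp
    show "norm (blinfun_apply (blinfun_compose (Blinfun ((*) c)) f) x) \<le> cmod c * norm f * norm x"
      using mult_left_mono[OF norm_blinfun[of f x], of "cmod c"]
      by (simp add: mult norm_mult mult.assoc)
  qed
  show "norm (c *\<^sub>C f) = cmod c * norm f"
  proof (cases "c = 0")
    case True
    have "0 *\<^sub>C f = 0"
      by transfer (auto intro!: blinfun_eqI simp: mult)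
    with True \<open>norm f = 0 \<longleftrightarrow> f = 0\<close> show ?thesis
      using le[of c f] by (metis mult_zero_left norm_cdual.rep_eq norm_ge_zero norm_zero order_antisym)
  next
    case False
    have "f = inverse c *\<^sub>C c *\<^sub>C f"
      using False by transfer (auto intro!: blinfun_eqI simp: mult)
    then have "norm f \<le> cmod (inverse c) * norm (c *\<^sub>C f)"
      using le[of "inverse c" "c *\<^sub>C f"] by simp
    from mult_left_mono[OF this, of "cmod c"]
    have "cmod c * norm f \<le> cmod c * (cmod (inverse c) * norm (c *\<^sub>C f))"
      by simp
    also have "\<dots> = norm (c *\<^sub>C f)"
      using False by (simp add: norm_inverse)
    finally have "cmod c * norm f \<le> norm (c *\<^sub>C f)" .
    with le[of c f] show ?thesis by simp
  qed
qed (rule dist_cdual_def sgn_cdual_def uniformity_cdual_def open_cdual_def)+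
end

definition capply :: "'a::complex_normed_vector cdual \<Rightarrow> 'a \<Rightarrow> complex" where
  "capply f = blinfun_apply (Rep_cdual f)"

definition cfunctional :: "('a::complex_normed_vector \<Rightarrow> complex) \<Rightarrow> 'a cdual" where
  "cfunctional f = Abs_cdual (Blinfun f)"

lemma capply_cfunctional:
  assumes "bounded_clinear f"
  shows "capply (cfunctional f) = f"
  using assms unfolding bounded_clinear_def capply_def cfunctional_def
  by (subst Abs_cdual_inverse) (auto simp: bounded_linear_Blinfun_apply scaleC_complex_def)

lemma bounded_clinear_capply: "bounded_clinear (capply f)"
  using Rep_cdual[of f]
  by (auto simp: bounded_clinear_def capply_def blinfun.bounded_linear_right scaleC_complex_def)

lemma cdual_eqI: "(\<And>x. capply f x = capply g x) \<Longrightarrow> f = g"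
  by (metis Rep_cdual_inject blinfun_eqI capply_def)

lemma capply_simps [simp]:
  "capply 0 x = 0" "capply (f + g) x = capply f x + capply g x"
  "capply (f - g) x = capply f x - capply g x" "capply (- f) x = - capply f x"
  "capply (c *\<^sub>C f) x = c * capply f x"
  by (simp_all add: capply_def zero_cdual.rep_eq plus_cdual.rep_eq minus_cdual.rep_eq
      uminus_cdual.rep_eq scaleC_cdual.rep_eq blinfun.bilinear_simps
      bounded_linear_Blinfun_apply bounded_linear_mult_right)

lemma norm_cdual_eq_onorm: "norm f = onorm (capply f)"
  by (simp add: norm_cdual.rep_eq norm_blinfun.rep_eq capply_def)

definition cadjoint ::
  "('a::complex_normed_vector \<Rightarrow> 'b::complex_normed_vector) \<Rightarrow> 'b cdual \<Rightarrow> 'a cdual" where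
  "cadjoint T f = cfunctional (\<lambda>x. capply f (T x))"

lemma capply_cadjoint:
  assumes "bounded_clinear T"
  shows "capply (cadjoint T f) x = capply f (T x)"
proof -
  have "bounded_clinear (\<lambda>x. capply f (T x))"
    using assms bounded_clinear_capply[of f]
    by (auto simp: bounded_clinear_def intro: bounded_linear_compose)
  then show ?thesis
    by (simp add: cadjoint_def capply_cfunctional)
qed

text \<open>The topological dual of a linear subspace \<open>V\<close> of a normed space; functionals on \<open>V\<close> are
  represented by functions that are \<open>undefined\<close> outside \<open>V\<close>.\<close>

definition subspace_dual :: "'a::complex_normed_vector set \<Rightarrow> ('a \<Rightarrow> complex) set" where
  "subspace_dual V = {\<phi> \<in> extensional V.
     (\<forall>x\<in>V. \<forall>y\<in>V. \<phi> (x + y) = \<phi> x + \<phi> y) \<and>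
     (\<forall>c. \<forall>x\<in>V. \<phi> (c *\<^sub>C x) = c * \<phi> x) \<and>
     (\<exists>K. \<forall>x\<in>V. cmod (\<phi> x) \<le> K * norm x)}"


section \<open>The projective tensor product\<close>

subsection \<open>The algebraic tensor product\<close>

abbreviation free_scale :: "complex \<Rightarrow> ('p \<Rightarrow>\<^sub>0 complex) \<Rightarrow> ('p \<Rightarrow>\<^sub>0 complex)" where
  "free_scale c \<equiv> Poly_Mapping.map ((*) c)"

lemma lookup_free_scale [simp]: "Poly_Mapping.lookup (free_scale c x) k = c * Poly_Mapping.lookup x k"
  by (simp add: Poly_Mapping.map.rep_eq when_def)

text \<open>\<open>'a \<times> 'b \<Rightarrow>\<^sub>0 complex\<close> is the free vector space on \<open>'a \<times> 'b\<close>; the algebraic tensor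
  product is its quotient by the subspace spanned by the bilinearity relations.\<close>

inductive_set bilin_rel :: "('a::complex_vector \<times> 'b::complex_vector \<Rightarrow>\<^sub>0 complex) set" where
  zero: "0 \<in> bilin_rel"
| add: "x \<in> bilin_rel \<Longrightarrow> y \<in> bilin_rel \<Longrightarrow> x + y \<in> bilin_rel"
| scale: "x \<in> bilin_rel \<Longrightarrow> free_scale c x \<in> bilin_rel"
| add_left: "Poly_Mapping.single (a + a', b) 1
    - (Poly_Mapping.single (a, b) 1 + Poly_Mapping.single (a', b) 1) \<in> bilin_rel"
| add_right: "Poly_Mapping.single (a, b + b') 1
    - (Poly_Mapping.single (a, b) 1 + Poly_Mapping.single (a, b') 1) \<in> bilin_rel"
| scale_left: "Poly_Mapping.single (c *\<^sub>C a, b) 1 - Poly_Mapping.single (a, b) c \<in> bilin_rel"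
| scale_right: "Poly_Mapping.single (a, c *\<^sub>C b) 1 - Poly_Mapping.single (a, b) c \<in> bilin_rel"

lemma bilin_rel_uminus: "x \<in> bilin_rel \<Longrightarrow> - x \<in> bilin_rel"
  using bilin_rel.scale[of x "-1"]
  by (metis (no_types, lifting) lookup_free_scale lookup_uminus mult_minus1 poly_mapping_eqI)

lemma bilin_rel_diff: "x \<in> bilin_rel \<Longrightarrow> y \<in> bilin_rel \<Longrightarrow> x - y \<in> bilin_rel"
  using bilin_rel.add[of x "- y"] bilin_rel_uminus[of y] by simp

quotient_type (overloaded) ('a, 'b) tensor =
  "('a::complex_vector \<times> 'b::complex_vector) \<Rightarrow>\<^sub>0 complex" / "\<lambda>x y. x - y \<in> bilin_rel"
proof (rule equivpI)
  show "reflp (\<lambda>x y::('a \<times> 'b) \<Rightarrow>\<^sub>0 complex. x - y \<in> bilin_rel)"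
    by (auto simp: reflp_def bilin_rel.zero)
  show "symp (\<lambda>x y::('a \<times> 'b) \<Rightarrow>\<^sub>0 complex. x - y \<in> bilin_rel)"
  proof (rule sympI)
    fix x y :: "('a \<times> 'b) \<Rightarrow>\<^sub>0 complex"
    assume "x - y \<in> bilin_rel"
    from bilin_rel_uminus[OF this] show "y - x \<in> bilin_rel" by simp
  qed
  show "transp (\<lambda>x y::('a \<times> 'b) \<Rightarrow>\<^sub>0 complex. x - y \<in> bilin_rel)"
  proof (rule transpI)
    fix x y z :: "('a \<times> 'b) \<Rightarrow>\<^sub>0 complex"
    assume "x - y \<in> bilin_rel" "y - z \<in> bilin_rel"
    from bilin_rel.add[OF this] show "x - z \<in> bilin_rel" by simp
  qed
qed

instantiation tensor :: (complex_vector, complex_vector) complex_vector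
begin
lift_definition zero_tensor :: "('a, 'b) tensor" is 0 .
lift_definition plus_tensor :: "('a, 'b) tensor \<Rightarrow> ('a, 'b) tensor \<Rightarrow> ('a, 'b) tensor" is "(+)"
proof -
  fix x x' y y' :: "('a \<times> 'b) \<Rightarrow>\<^sub>0 complex"
  assume "x - x' \<in> bilin_rel" "y - y' \<in> bilin_rel"
  then have "(x - x') + (y - y') \<in> bilin_rel" by (rule bilin_rel.add)
  moreover have "(x - x') + (y - y') = (x + y) - (x' + y')" by (simp add: algebra_simps)
  ultimately show "(x + y) - (x' + y') \<in> bilin_rel" by simp
qed
lift_definition uminus_tensor :: "('a, 'b) tensor \<Rightarrow> ('a, 'b) tensor" is uminus
proof -
  fix x y :: "('a \<times> 'b) \<Rightarrow>\<^sub>0 complex"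
  assume "x - y \<in> bilin_rel"
  from bilin_rel_uminus[OF this] show "- x - - y \<in> bilin_rel" by simp
qed
lift_definition minus_tensor :: "('a, 'b) tensor \<Rightarrow> ('a, 'b) tensor \<Rightarrow> ('a, 'b) tensor" is "(-)"
proof -
  fix x x' y y' :: "('a \<times> 'b) \<Rightarrow>\<^sub>0 complex"
  assume "x - x' \<in> bilin_rel" "y - y' \<in> bilin_rel"
  then have "(x - x') - (y - y') \<in> bilin_rel" by (rule bilin_rel_diff)
  moreover have "(x - x') - (y - y') = (x - y) - (x' - y')" by (simp add: algebra_simps)
  ultimately show "(x - y) - (x' - y') \<in> bilin_rel" by simp
qed
lift_definition scaleC_tensor :: "complex \<Rightarrow> ('a, 'b) tensor \<Rightarrow> ('a, 'b) tensor" is free_scale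
proof -
  fix c and x y :: "('a \<times> 'b) \<Rightarrow>\<^sub>0 complex"
  assume "x - y \<in> bilin_rel"
  moreover have "free_scale c x - free_scale c y = free_scale c (x - y)"
    by (rule poly_mapping_eqI) (simp add: lookup_minus right_diff_distrib)
  ultimately show "free_scale c x - free_scale c y \<in> bilin_rel"
    using bilin_rel.scale by metis
qed
definition scaleR_tensor :: "real \<Rightarrow> ('a, 'b) tensor \<Rightarrow> ('a, 'b) tensor" where
  "scaleR_tensor r x = of_real r *\<^sub>C x"
instance
proof
  fix x y z :: "('a, 'b) tensor" and r s :: real and c d :: complex
  have eq: "x = y \<Longrightarrow> x - y \<in> bilin_rel" for x y :: "('a \<times> 'b) \<Rightarrow>\<^sub>0 complex"
    by (simp add: bilin_rel.zero)
  have C1: "c *\<^sub>C (x + y) = c *\<^sub>C x + c *\<^sub>C y" for c and x y :: "('a, 'b) tensor"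
    by transfer (rule eq, rule poly_mapping_eqI, simp add: lookup_add distrib_left)
  have C2: "(c + d) *\<^sub>C x = c *\<^sub>C x + d *\<^sub>C x" for c d and x :: "('a, 'b) tensor"
    by transfer (rule eq, rule poly_mapping_eqI, simp add: lookup_add distrib_right)
  have C3: "c *\<^sub>C d *\<^sub>C x = (c * d) *\<^sub>C x" for c d and x :: "('a, 'b) tensor"
    by transfer (rule eq, rule poly_mapping_eqI, simp)
  have C4: "1 *\<^sub>C x = x" for x :: "('a, 'b) tensor"
    by transfer (rule eq, rule poly_mapping_eqI, simp)
  show "x + y + z = x + (y + z)" by transfer (rule eq, simp add: add.assoc)
  show "x + y = y + x" by transfer (rule eq, simp add: add.commute)
  show "0 + x = x" by transfer (rule eq, simp)
  show "- x + x = 0" by transfer (rule eq, simp)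
  show "x - y = x + - y" by transfer (rule eq, simp)
  show "c *\<^sub>C (x + y) = c *\<^sub>C x + c *\<^sub>C y" "(c + d) *\<^sub>C x = c *\<^sub>C x + d *\<^sub>C x"
    "c *\<^sub>C d *\<^sub>C x = (c * d) *\<^sub>C x"
    by (fact C1 C2 C3)+
  show "r *\<^sub>R (x + y) = r *\<^sub>R x + r *\<^sub>R y" "(r + s) *\<^sub>R x = r *\<^sub>R x + s *\<^sub>R x"
    "r *\<^sub>R s *\<^sub>R x = (r * s) *\<^sub>R x" "1 *\<^sub>R x = x" "of_real r *\<^sub>C x = r *\<^sub>R x"
    by (simp_all add: scaleR_tensor_def C1 C2 C3 C4)
qed
end

lift_definition tens :: "'a::complex_vector \<Rightarrow> 'b::complex_vector \<Rightarrow> ('a, 'b) tensor"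
  is "\<lambda>a b. Poly_Mapping.single (a, b) 1" .

lemma tens_add_left: "tens (a + a') b = tens a b + tens a' b"
  by transfer (rule bilin_rel.add_left)

lemma tens_add_right: "tens a (b + b') = tens a b + tens a b'"
  by transfer (rule bilin_rel.add_right)

lemma free_scale_single: "free_scale c (Poly_Mapping.single k d) = Poly_Mapping.single k (c * d)"
  by (rule poly_mapping_eqI) (simp add: lookup_single when_def)

lemma tens_scaleC_left: "tens (c *\<^sub>C a) b = c *\<^sub>C tens a b"
  by transfer (use bilin_rel.scale_left in \<open>simp add: free_scale_single\<close>)

lemma tens_scaleC_right: "tens a (c *\<^sub>C b) = c *\<^sub>C tens a b"
  by transfer (use bilin_rel.scale_right in \<open>simp add: free_scale_single\<close>)

definition tens_sum :: "('a::complex_vector \<times> 'b::complex_vector) list \<Rightarrow> ('a, 'b) tensor" where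
  "tens_sum xs = (\<Sum>(a, b)\<leftarrow>xs. tens a b)"

lemma tens_sum_simps [simp]:
  "tens_sum [] = 0" "tens_sum (p # xs) = tens (fst p) (snd p) + tens_sum xs"
  "tens_sum (xs @ ys) = tens_sum xs + tens_sum ys"
  by (auto simp: tens_sum_def split: prod.splits)

lemma tensor_abs_exists: "\<exists>x. u = abs_tensor x"
  by (rule exI[of _ "rep_tensor u"]) (rule Quotient3_abs_rep[OF Quotient3_tensor, symmetric])

lemma tensor_is_tens_sum:
  fixes u :: "('a::complex_vector, 'b::complex_vector) tensor"
  shows "\<exists>xs. u = tens_sum xs"
proof -
  obtain x where x: "u = abs_tensor x"
    using tensor_abs_exists by blast
  have abs_add: "abs_tensor (x + y) = abs_tensor x + abs_tensor y" for x y :: "('a \<times> 'b) \<Rightarrow>\<^sub>0 complex"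
    by (simp add: plus_tensor.abs_eq)
  have sums: "\<exists>xs. abs_tensor (\<Sum>k\<in>K. Poly_Mapping.single k (Poly_Mapping.lookup x k)) = tens_sum xs" if "finite K" for K
    using that
  proof (induction K)
    case empty
    then show ?case
      by (intro exI[of _ "[]"]) (simp add: zero_tensor_def)
  next
    case (insert k K)
    then obtain xs where xs: "abs_tensor (\<Sum>k\<in>K. Poly_Mapping.single k (Poly_Mapping.lookup x k)) = tens_sum xs"
      by blast
    have "abs_tensor (Poly_Mapping.single k (Poly_Mapping.lookup x k)) = tens (Poly_Mapping.lookup x k *\<^sub>C fst k) (snd k)"
      unfolding tens_scaleC_left by (simp add: tens.abs_eq scaleC_tensor.abs_eq free_scale_single)
    with insert xs show ?case
      by (intro exI[of _ "(Poly_Mapping.lookup x k *\<^sub>C fst k, snd k) # xs"]) (simp add: abs_add)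
  qed
  have "(\<Sum>k\<in>Poly_Mapping.keys x. Poly_Mapping.single k (Poly_Mapping.lookup x k)) = x"
  proof (rule poly_mapping_eqI)
    fix k
    show "Poly_Mapping.lookup (\<Sum>k\<in>Poly_Mapping.keys x. Poly_Mapping.single k (Poly_Mapping.lookup x k)) k = Poly_Mapping.lookup x k"
      by (simp add: lookup_sum lookup_single when_def in_keys_iff)
  qed
  with sums[OF finite_keys, of x] x show ?thesis by simp
qed

definition free_lift :: "('a \<Rightarrow> 'b \<Rightarrow> 'c::complex_vector) \<Rightarrow> ('a \<times> 'b \<Rightarrow>\<^sub>0 complex) \<Rightarrow> 'c" where
  "free_lift B x = (\<Sum>k\<in>Poly_Mapping.keys x. Poly_Mapping.lookup x k *\<^sub>C B (fst k) (snd k))"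

lemma free_lift_superset:
  assumes "finite K" "Poly_Mapping.keys x \<subseteq> K"
  shows "free_lift B x = (\<Sum>k\<in>K. Poly_Mapping.lookup x k *\<^sub>C B (fst k) (snd k))"
  unfolding free_lift_def using assms by (intro sum.mono_neutral_left) (auto simp: in_keys_iff)

lemma free_lift_add: "free_lift B (x + y) = free_lift B x + free_lift B y"
proof -
  let ?K = "Poly_Mapping.keys x \<union> Poly_Mapping.keys y"
  have "Poly_Mapping.keys (x + y) \<subseteq> ?K" by (rule keys_add)
  then show ?thesis
    by (simp add: free_lift_superset[of ?K] lookup_add scaleC_add_left sum.distrib)
qed

lemma free_lift_scale: "free_lift B (free_scale c x) = c *\<^sub>C free_lift B x"
proof -
  have "Poly_Mapping.keys (free_scale c x) \<subseteq> Poly_Mapping.keys x" by (auto simp: in_keys_iff)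
  then show ?thesis
    by (simp add: free_lift_superset[of "Poly_Mapping.keys x"] scaleC_sum_right scaleC_scaleC)
qed

lemma free_lift_diff: "free_lift B (x - y) = free_lift B x - free_lift B y"
  using free_lift_add[of B "x - y" y] by simp

lemma free_lift_single: "free_lift B (Poly_Mapping.single k c) = c *\<^sub>C B (fst k) (snd k)"
  by (simp add: free_lift_superset[of "{k}"])

lemma tensor_lift_exists:
  fixes B :: "'a::complex_vector \<Rightarrow> 'b::complex_vector \<Rightarrow> 'c::complex_vector"
  assumes "\<And>a a' b. B (a + a') b = B a b + B a' b" "\<And>a b b'. B a (b + b') = B a b + B a b'"
    "\<And>c a b. B (c *\<^sub>C a) b = c *\<^sub>C B a b" "\<And>c a b. B a (c *\<^sub>C b) = c *\<^sub>C B a b"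
  shows "\<exists>F. (\<forall>u v. F (u + v) = F u + F v) \<and> (\<forall>c u. F (c *\<^sub>C u) = c *\<^sub>C F u)
    \<and> (\<forall>a b. F (tens a b) = B a b)"
proof -
  have rel: "free_lift B x = 0" if "x \<in> bilin_rel" for x
    using that
    by induction
      (simp_all add: free_lift_add free_lift_diff free_lift_scale free_lift_single assms,
        simp add: free_lift_def)
  have abs: "free_lift B (rep_tensor (abs_tensor x)) = free_lift B x" for x
  proof -
    have "rep_tensor (abs_tensor x) - x \<in> bilin_rel"
      using Quotient3_rep_abs[OF Quotient3_tensor, of x] by (simp add: bilin_rel.zero)
    then show ?thesis using rel free_lift_diff by (metis eq_iff_diff_eq_0)
  qed
  define F where "F = (\<lambda>u. free_lift B (rep_tensor u))"
  have "F (u + v) = F u + F v" for u v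
    using tensor_abs_exists[of u] tensor_abs_exists[of v] by (auto simp: F_def plus_tensor.abs_eq abs free_lift_add)
  moreover have "F (c *\<^sub>C u) = c *\<^sub>C F u" for c u
    using tensor_abs_exists[of u] by (auto simp: F_def scaleC_tensor.abs_eq abs free_lift_scale)
  moreover have "F (tens a b) = B a b" for a b
    by (simp add: F_def tens.abs_eq abs free_lift_single)
  ultimately show ?thesis by blast
qed


subsection \<open>The projective norm\<close>

definition tens_cost :: "('a::complex_normed_vector \<times> 'b::complex_normed_vector) list \<Rightarrow> real" where
  "tens_cost xs = (\<Sum>(a, b)\<leftarrow>xs. norm a * norm b)"

definition proj_norm :: "('a::complex_normed_vector, 'b::complex_normed_vector) tensor \<Rightarrow> real" where
  "proj_norm u = Inf {tens_cost xs | xs. u = tens_sum xs}"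

lemma tens_cost_simps [simp]:
  "tens_cost [] = 0" "tens_cost (p # xs) = norm (fst p) * norm (snd p) + tens_cost xs"
  "tens_cost (xs @ ys) = tens_cost xs + tens_cost ys"
  by (auto simp: tens_cost_def split: prod.splits)

lemma tens_cost_nonneg: "0 \<le> tens_cost xs"
  by (induction xs) auto

lemma proj_norm_le: "proj_norm (tens_sum xs) \<le> tens_cost xs"
  unfolding proj_norm_def
  by (rule cInf_lower) (auto intro!: bdd_belowI[of _ 0] simp: tens_cost_nonneg)

lemma proj_norm_greatest:
  assumes "\<And>xs. u = tens_sum xs \<Longrightarrow> K \<le> tens_cost xs"
  shows "K \<le> proj_norm u"
  unfolding proj_norm_def using tensor_is_tens_sum[of u] assms
  by (intro cInf_greatest) auto

lemma proj_norm_nonneg [simp]: "0 \<le> proj_norm u"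
  by (rule proj_norm_greatest) (rule tens_cost_nonneg)

lemma proj_norm_zero [simp]: "proj_norm 0 = 0"
  using proj_norm_le[of "[]"] by (intro order_antisym) simp_all

lemma proj_norm_tens: "proj_norm (tens a b) \<le> norm a * norm b"
  using proj_norm_le[of "[(a, b)]"] by simp

lemma proj_norm_triangle: "proj_norm (u + v) \<le> proj_norm u + proj_norm v"
proof -
  have "proj_norm (u + v) - tens_cost xs \<le> tens_cost ys" if "u = tens_sum xs" "v = tens_sum ys" for xs ys
    using proj_norm_le[of "xs @ ys"] that by simp
  then have "proj_norm (u + v) - tens_cost xs \<le> proj_norm v" if "u = tens_sum xs" for xs
    using that by (intro proj_norm_greatest) auto
  then have "proj_norm (u + v) - proj_norm v \<le> proj_norm u"
    by (intro proj_norm_greatest) (simp add: algebra_simps)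
  then show ?thesis by simp
qed

lemma proj_norm_scaleC_le: "proj_norm (c *\<^sub>C u) \<le> cmod c * proj_norm u"
proof (cases "c = 0")
  case False
  have "proj_norm (c *\<^sub>C u) / cmod c \<le> tens_cost xs" if u: "u = tens_sum xs" for xs
  proof -
    let ?ys = "map (\<lambda>(a, b). (c *\<^sub>C a, b)) xs"
    have "tens_sum ?ys = c *\<^sub>C tens_sum xs"
      by (induction xs) (auto simp: tens_scaleC_left scaleC_add_right)
    moreover have "tens_cost ?ys = cmod c * tens_cost xs"
      by (induction xs) (auto simp: norm_scaleC distrib_left)
    ultimately show ?thesis
      using proj_norm_le[of ?ys] False u by (simp add: divide_le_eq mult.commute)
  qed
  then have "proj_norm (c *\<^sub>C u) / cmod c \<le> proj_norm u"
    by (rule proj_norm_greatest)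
  then show ?thesis using False by (simp add: divide_le_eq mult.commute)
qed simp

lemma proj_norm_scaleC: "proj_norm (c *\<^sub>C u) = cmod c * proj_norm u"
proof (cases "c = 0")
  case False
  have "proj_norm u \<le> cmod (inverse c) * proj_norm (c *\<^sub>C u)"
    using proj_norm_scaleC_le[of "inverse c" "c *\<^sub>C u"] False by (simp add: scaleC_scaleC)
  from mult_left_mono[OF this, of "cmod c"]
  have "cmod c * proj_norm u \<le> cmod c * (cmod (inverse c) * proj_norm (c *\<^sub>C u))"
    by simp
  also have "\<dots> = proj_norm (c *\<^sub>C u)"
    using False by (simp add: norm_inverse)
  finally have "cmod c * proj_norm u \<le> proj_norm (c *\<^sub>C u)" .
  then show ?thesis using proj_norm_scaleC_le[of c u] by simp
qed simp

lemma proj_norm_uminus [simp]: "proj_norm (- u) = proj_norm u"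
  using proj_norm_scaleC[of "-1" u] by (simp add: scaleC_minus1)

lemma proj_norm_minus_commute: "proj_norm (u - v) = proj_norm (v - u)"
  using proj_norm_uminus[of "u - v"] by simp

lemma proj_norm_diff_triangle: "proj_norm (u - w) \<le> proj_norm (u - v) + proj_norm (v - w)"
  using proj_norm_triangle[of "u - v" "v - w"] by simp

lemma proj_norm_abs_diff: "\<bar>proj_norm u - proj_norm v\<bar> \<le> proj_norm (u - v)"
  using proj_norm_triangle[of "u - v" v] proj_norm_triangle[of "v - u" u]
    proj_norm_minus_commute[of u v]
  by (simp add: abs_le_iff)

lemma proj_norm_add_diff: "proj_norm ((u + v) - (u' + v')) \<le> proj_norm (u - u') + proj_norm (v - v')"
  using proj_norm_triangle[of "u - u'" "v - v'"] by (simp add: algebra_simps)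


subsection \<open>The completion\<close>

definition proj_cauchy ::
  "(nat \<Rightarrow> ('a::complex_normed_vector, 'b::complex_normed_vector) tensor) \<Rightarrow> bool" where
  "proj_cauchy X \<longleftrightarrow> (\<forall>e>0. \<exists>N. \<forall>m\<ge>N. \<forall>n\<ge>N. proj_norm (X m - X n) < e)"

definition proj_equiv ::
  "(nat \<Rightarrow> ('a::complex_normed_vector, 'b::complex_normed_vector) tensor) \<Rightarrow>
   (nat \<Rightarrow> ('a, 'b) tensor) \<Rightarrow> bool" where
  "proj_equiv X Y \<longleftrightarrow> proj_cauchy X \<and> proj_cauchy Y \<and> (\<lambda>n. proj_norm (X n - Y n)) \<longlonglongrightarrow> 0"

lemma proj_cauchy_const [simp]: "proj_cauchy (\<lambda>_. u)"
  by (auto simp: proj_cauchy_def)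

lemma proj_cauchy_add:
  assumes "proj_cauchy X" "proj_cauchy Y" shows "proj_cauchy (\<lambda>n. X n + Y n)"
  unfolding proj_cauchy_def
proof (intro allI impI)
  fix e :: real assume "e > 0"
  then have "e/2 > 0" by simp
  then obtain M N where M: "\<And>m n. m \<ge> M \<Longrightarrow> n \<ge> M \<Longrightarrow> proj_norm (X m - X n) < e/2"
    and N: "\<And>m n. m \<ge> N \<Longrightarrow> n \<ge> N \<Longrightarrow> proj_norm (Y m - Y n) < e/2"
    using assms unfolding proj_cauchy_def by meson
  have "proj_norm ((X m + Y m) - (X n + Y n)) < e" if "m \<ge> max M N" "n \<ge> max M N" for m n
    using M[of m n] N[of m n] proj_norm_add_diff[of "X m" "Y m" "X n" "Y n"] that by simp
  then show "\<exists>N. \<forall>m\<ge>N. \<forall>n\<ge>N. proj_norm ((X m + Y m) - (X n + Y n)) < e" by blast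
qed

lemma proj_cauchy_scaleC:
  assumes "proj_cauchy X" shows "proj_cauchy (\<lambda>n. c *\<^sub>C X n)"
proof (cases "c = 0")
  case False
  show ?thesis
    unfolding proj_cauchy_def
  proof (intro allI impI)
    fix e :: real assume "e > 0"
    then have "e / cmod c > 0" using False by simp
    then obtain N where N: "\<And>m n. m \<ge> N \<Longrightarrow> n \<ge> N \<Longrightarrow> proj_norm (X m - X n) < e / cmod c"
      using assms unfolding proj_cauchy_def by meson
    then have "proj_norm (c *\<^sub>C X m - c *\<^sub>C X n) < e" if "m \<ge> N" "n \<ge> N" for m n
      using that False
      by (simp add: scaleC_diff_right[symmetric] proj_norm_scaleC pos_less_divide_eq mult.commute)
    then show "\<exists>N. \<forall>m\<ge>N. \<forall>n\<ge>N. proj_norm (c *\<^sub>C X m - c *\<^sub>C X n) < e" by blast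
  qed
qed simp

lemma proj_cauchy_uminus: "proj_cauchy X \<Longrightarrow> proj_cauchy (\<lambda>n. - X n)"
  using proj_cauchy_scaleC[of X "-1"] by (simp add: scaleC_minus1)

lemma proj_cauchy_diff: "proj_cauchy X \<Longrightarrow> proj_cauchy Y \<Longrightarrow> proj_cauchy (\<lambda>n. X n - Y n)"
  using proj_cauchy_add[of X "\<lambda>n. - Y n"] proj_cauchy_uminus[of Y] by simp

lemma proj_cauchy_convergent_norm:
  assumes "proj_cauchy X" shows "convergent (\<lambda>n. proj_norm (X n))"
proof -
  have "Cauchy (\<lambda>n. proj_norm (X n))"
    using assms unfolding proj_cauchy_def Cauchy_def dist_real_def
    by (meson order_le_less_trans proj_norm_abs_diff)
  then show ?thesis by (simp add: Cauchy_convergent_iff)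
qed

lemma proj_null_sandwich:
  assumes "\<And>n. proj_norm (Z n) \<le> f n" "f \<longlonglongrightarrow> 0"
  shows "(\<lambda>n. proj_norm (Z n)) \<longlonglongrightarrow> 0"
  by (rule tendsto_sandwich[OF _ _ tendsto_const assms(2)]) (simp_all add: assms(1))

quotient_type (overloaded) ('a, 'b) ptensor =
  "nat \<Rightarrow> ('a::complex_normed_vector, 'b::complex_normed_vector) tensor" / partial: proj_equiv
proof (rule part_equivpI)
  show "\<exists>X::nat \<Rightarrow> ('a, 'b) tensor. proj_equiv X X"
    by (rule exI[of _ "\<lambda>_. 0"]) (simp add: proj_equiv_def)
  show "symp (proj_equiv :: (nat \<Rightarrow> ('a, 'b) tensor) \<Rightarrow> _)"
    by (auto simp: symp_def proj_equiv_def proj_norm_minus_commute)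
  show "transp (proj_equiv :: (nat \<Rightarrow> ('a, 'b) tensor) \<Rightarrow> _)"
  proof (rule transpI)
    fix X Y Z :: "nat \<Rightarrow> ('a, 'b) tensor"
    assume *: "proj_equiv X Y" "proj_equiv Y Z"
    have "(\<lambda>n. proj_norm (X n - Z n)) \<longlonglongrightarrow> 0"
    proof (rule proj_null_sandwich)
      show "proj_norm (X n - Z n) \<le> proj_norm (X n - Y n) + proj_norm (Y n - Z n)" for n
        by (rule proj_norm_diff_triangle)
      show "(\<lambda>n. proj_norm (X n - Y n) + proj_norm (Y n - Z n)) \<longlonglongrightarrow> 0"
        using * tendsto_add[of _ 0 _ _ 0] by (fastforce simp: proj_equiv_def)
    qed
    with * show "proj_equiv X Z" by (simp add: proj_equiv_def)
  qed
qed

instantiation ptensor :: (complex_normed_vector, complex_normed_vector) complex_normed_vector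
begin
lift_definition zero_ptensor :: "('a, 'b) ptensor" is "\<lambda>_. 0"
  by (simp add: proj_equiv_def)
lift_definition plus_ptensor :: "('a, 'b) ptensor \<Rightarrow> ('a, 'b) ptensor \<Rightarrow> ('a, 'b) ptensor"
  is "\<lambda>X Y n. X n + Y n"
proof -
  fix X X' Y Y' :: "nat \<Rightarrow> ('a, 'b) tensor"
  assume *: "proj_equiv X X'" "proj_equiv Y Y'"
  have "(\<lambda>n. proj_norm ((X n + Y n) - (X' n + Y' n))) \<longlonglongrightarrow> 0"
  proof (rule proj_null_sandwich)
    show "proj_norm ((X n + Y n) - (X' n + Y' n)) \<le> proj_norm (X n - X' n) + proj_norm (Y n - Y' n)" for n
      by (rule proj_norm_add_diff)
    show "(\<lambda>n. proj_norm (X n - X' n) + proj_norm (Y n - Y' n)) \<longlonglongrightarrow> 0"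
      using * tendsto_add[of _ 0 _ _ 0] by (fastforce simp: proj_equiv_def)
  qed
  with * show "proj_equiv (\<lambda>n. X n + Y n) (\<lambda>n. X' n + Y' n)"
    by (simp add: proj_equiv_def proj_cauchy_add)
qed
lift_definition scaleC_ptensor :: "complex \<Rightarrow> ('a, 'b) ptensor \<Rightarrow> ('a, 'b) ptensor"
  is "\<lambda>c X n. c *\<^sub>C X n"
proof -
  fix c and X X' :: "nat \<Rightarrow> ('a, 'b) tensor"
  assume *: "proj_equiv X X'"
  then have "(\<lambda>n. cmod c * proj_norm (X n - X' n)) \<longlonglongrightarrow> cmod c * 0"
    by (intro tendsto_mult tendsto_const) (simp add: proj_equiv_def)
  with * show "proj_equiv (\<lambda>n. c *\<^sub>C X n) (\<lambda>n. c *\<^sub>C X' n)"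
    by (simp add: proj_equiv_def proj_cauchy_scaleC scaleC_diff_right[symmetric] proj_norm_scaleC)
qed
lift_definition norm_ptensor :: "('a, 'b) ptensor \<Rightarrow> real" is "\<lambda>X. lim (\<lambda>n. proj_norm (X n))"
proof -
  fix X X' :: "nat \<Rightarrow> ('a, 'b) tensor"
  assume *: "proj_equiv X X'"
  then obtain l where l: "(\<lambda>n. proj_norm (X n)) \<longlonglongrightarrow> l"
    using proj_cauchy_convergent_norm by (auto simp: proj_equiv_def convergent_def)
  have "(\<lambda>n. \<bar>proj_norm (X n) - proj_norm (X' n)\<bar>) \<longlonglongrightarrow> 0"
    by (rule tendsto_sandwich[where f = "\<lambda>_. 0" and h = "\<lambda>n. proj_norm (X n - X' n)"])
      (use * in \<open>auto simp: proj_norm_abs_diff proj_equiv_def\<close>)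
  then have "(\<lambda>n. proj_norm (X n) - proj_norm (X' n)) \<longlonglongrightarrow> 0"
    by (simp add: tendsto_rabs_zero_iff)
  from tendsto_diff[OF l this] have "(\<lambda>n. proj_norm (X' n)) \<longlonglongrightarrow> l" by simp
  with l show "lim (\<lambda>n. proj_norm (X n)) = lim (\<lambda>n. proj_norm (X' n))"
    by (simp add: limI)
qed
definition uminus_ptensor :: "('a, 'b) ptensor \<Rightarrow> ('a, 'b) ptensor" where
  "uminus_ptensor x = (- 1) *\<^sub>C x"
definition minus_ptensor :: "('a, 'b) ptensor \<Rightarrow> ('a, 'b) ptensor \<Rightarrow> ('a, 'b) ptensor" where
  "minus_ptensor x y = x + - y"
definition scaleR_ptensor :: "real \<Rightarrow> ('a, 'b) ptensor \<Rightarrow> ('a, 'b) ptensor" where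
  "scaleR_ptensor r x = of_real r *\<^sub>C x"
definition dist_ptensor :: "('a, 'b) ptensor \<Rightarrow> ('a, 'b) ptensor \<Rightarrow> real" where
  "dist_ptensor x y = norm (x - y)"
definition sgn_ptensor :: "('a, 'b) ptensor \<Rightarrow> ('a, 'b) ptensor" where
  "sgn_ptensor x = inverse (norm x) *\<^sub>R x"
definition uniformity_ptensor :: "(('a, 'b) ptensor \<times> ('a, 'b) ptensor) filter" where
  "uniformity_ptensor = (INF e\<in>{0<..}. principal {(x, y). dist x y < e})"
definition open_ptensor :: "('a, 'b) ptensor set \<Rightarrow> bool" where
  "open_ptensor U = (\<forall>x\<in>U. eventually (\<lambda>(x', y). x' = x \<longrightarrow> y \<in> U) uniformity)"
instance
proof
  fix x y z :: "('a, 'b) ptensor" and r s :: real and c d :: complex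
  have eq: "X = Y \<Longrightarrow> proj_equiv X X \<Longrightarrow> proj_equiv X Y" for X Y :: "nat \<Rightarrow> ('a, 'b) tensor"
    by simp
  have refl: "proj_equiv X X" if "proj_cauchy X" for X :: "nat \<Rightarrow> ('a, 'b) tensor"
    using that by (simp add: proj_equiv_def)
  note cauchy = proj_cauchy_add proj_cauchy_scaleC
  have C1: "c *\<^sub>C (x + y) = c *\<^sub>C x + c *\<^sub>C y" for c and x y :: "('a, 'b) ptensor"
    by transfer (simp add: proj_equiv_def scaleC_add_right cauchy)
  have C2: "(c + d) *\<^sub>C x = c *\<^sub>C x + d *\<^sub>C x" for c d and x :: "('a, 'b) ptensor"
    by transfer (simp add: proj_equiv_def scaleC_add_left cauchy)
  have C3: "c *\<^sub>C d *\<^sub>C x = (c * d) *\<^sub>C x" for c d and x :: "('a, 'b) ptensor"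
    by transfer (simp add: proj_equiv_def scaleC_scaleC cauchy)
  have C4: "1 *\<^sub>C x = x" for x :: "('a, 'b) ptensor"
    by transfer (simp add: proj_equiv_def)
  have C0: "0 *\<^sub>C x = 0" for x :: "('a, 'b) ptensor"
    by transfer (simp add: proj_equiv_def)
  show "x + y + z = x + (y + z)" by transfer (simp add: proj_equiv_def cauchy add.assoc)
  show "x + y = y + x" by transfer (simp add: proj_equiv_def cauchy add.commute)
  show "0 + x = x" by transfer (simp add: proj_equiv_def)
  show "- x + x = 0"
    using C2[of "-1" 1 x] by (simp add: uminus_ptensor_def C4 C0)
  show "x - y = x + - y" by (rule minus_ptensor_def)
  show "c *\<^sub>C (x + y) = c *\<^sub>C x + c *\<^sub>C y" "(c + d) *\<^sub>C x = c *\<^sub>C x + d *\<^sub>C x"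
    "c *\<^sub>C d *\<^sub>C x = (c * d) *\<^sub>C x"
    by (fact C1 C2 C3)+
  show "r *\<^sub>R (x + y) = r *\<^sub>R x + r *\<^sub>R y" "(r + s) *\<^sub>R x = r *\<^sub>R x + s *\<^sub>R x"
    "r *\<^sub>R s *\<^sub>R x = (r * s) *\<^sub>R x" "1 *\<^sub>R x = x" "of_real r *\<^sub>C x = r *\<^sub>R x"
    by (simp_all add: scaleR_ptensor_def C1 C2 C3 C4)
  have lim: "(\<lambda>n. proj_norm (X n)) \<longlonglongrightarrow> lim (\<lambda>n. proj_norm (X n))"
    if "proj_equiv X X" for X :: "nat \<Rightarrow> ('a, 'b) tensor"
    using that proj_cauchy_convergent_norm[of X] by (simp add: proj_equiv_def convergent_LIMSEQ_iff)
  show "norm x = 0 \<longleftrightarrow> x = 0"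
  proof transfer
    fix X :: "nat \<Rightarrow> ('a, 'b) tensor"
    assume X: "proj_equiv X X"
    then show "lim (\<lambda>n. proj_norm (X n)) = 0 \<longleftrightarrow> proj_equiv X (\<lambda>_. 0)"
      using lim[OF X] limI by (auto simp: proj_equiv_def)
  qed
  show "norm (x + y) \<le> norm x + norm y"
  proof transfer
    fix X Y :: "nat \<Rightarrow> ('a, 'b) tensor"
    assume *: "proj_equiv X X" "proj_equiv Y Y"
    then have "proj_equiv (\<lambda>n. X n + Y n) (\<lambda>n. X n + Y n)"
      by (simp add: proj_equiv_def cauchy)
    from LIMSEQ_le[OF lim[OF this] tendsto_add[OF lim[OF *(1)] lim[OF *(2)]]]
    show "lim (\<lambda>n. proj_norm (X n + Y n)) \<le> lim (\<lambda>n. proj_norm (X n)) + lim (\<lambda>n. proj_norm (Y n))"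
      using proj_norm_triangle by blast
  qed
  show N: "norm (c *\<^sub>C x) = cmod c * norm x" for c and x :: "('a, 'b) ptensor"
  proof transfer
    fix c and X :: "nat \<Rightarrow> ('a, 'b) tensor"
    assume X: "proj_equiv X X"
    show "lim (\<lambda>n. proj_norm (c *\<^sub>C X n)) = cmod c * lim (\<lambda>n. proj_norm (X n))"
      by (rule limI) (simp add: proj_norm_scaleC tendsto_mult[OF tendsto_const lim[OF X]])
  qed
  show "norm (r *\<^sub>R x) = \<bar>r\<bar> * norm x"
    by (simp add: scaleR_ptensor_def N)
qed (rule dist_ptensor_def sgn_ptensor_def uniformity_ptensor_def open_ptensor_def)+
end

definition ptensor_of ::
  "('a::complex_normed_vector, 'b::complex_normed_vector) tensor \<Rightarrow> ('a, 'b) ptensor" where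
  "ptensor_of u = abs_ptensor (\<lambda>_. u)"

lemma proj_equiv_refl: "proj_cauchy X \<Longrightarrow> proj_equiv X X"
  by (simp add: proj_equiv_def)

lemma norm_abs_ptensor: "proj_cauchy X \<Longrightarrow> norm (abs_ptensor X) = lim (\<lambda>n. proj_norm (X n))"
  by (simp add: norm_ptensor.abs_eq proj_equiv_refl)

lemma norm_ptensor_of [simp]: "norm (ptensor_of u) = proj_norm u"
  by (simp add: ptensor_of_def norm_abs_ptensor)

lemma ptensor_of_add: "ptensor_of (u + v) = ptensor_of u + ptensor_of v"
  by (simp add: ptensor_of_def plus_ptensor.abs_eq proj_equiv_refl)

lemma ptensor_of_scaleC: "ptensor_of (c *\<^sub>C u) = c *\<^sub>C ptensor_of u"
  by (simp add: ptensor_of_def scaleC_ptensor.abs_eq proj_equiv_refl)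

lemma ptensor_of_diff: "ptensor_of (u - v) = ptensor_of u - ptensor_of v"
  using ptensor_of_add[of "u - v" v] by simp

lemma ptensor_abs_exists: "\<exists>X. proj_cauchy X \<and> x = abs_ptensor X"
proof -
  have "proj_equiv (rep_ptensor x) (rep_ptensor x)" "abs_ptensor (rep_ptensor x) = x"
    using Quotient3_ptensor Quotient3_rep_reflp Quotient3_abs_rep by fastforce+
  then show ?thesis by (metis proj_equiv_def)
qed

lemma ptensor_tendsto:
  assumes X: "proj_cauchy X"
  shows "(\<lambda>n. ptensor_of (X n)) \<longlonglongrightarrow> abs_ptensor X"
proof (rule LIMSEQ_I)
  fix e :: real assume "e > 0"
  then have "e / 2 > 0" by simp
  then obtain N where N: "\<And>m n. m \<ge> N \<Longrightarrow> n \<ge> N \<Longrightarrow> proj_norm (X m - X n) < e / 2"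
    using assms unfolding proj_cauchy_def by meson
  have "norm (ptensor_of (X n) - abs_ptensor X) < e" if "n \<ge> N" for n
  proof -
    have "abs_ptensor (\<lambda>m. X n - X m) + abs_ptensor X = ptensor_of (X n)"
      using X by (simp add: ptensor_of_def plus_ptensor.abs_eq proj_equiv_refl proj_cauchy_diff)
    then have "ptensor_of (X n) - abs_ptensor X = abs_ptensor (\<lambda>m. X n - X m)"
      by (simp add: eq_diff_eq diff_eq_eq)
    then have "norm (ptensor_of (X n) - abs_ptensor X) = lim (\<lambda>m. proj_norm (X n - X m))"
      using X by (simp add: norm_abs_ptensor proj_cauchy_diff)
    also have "\<dots> \<le> e / 2"
    proof (rule LIMSEQ_le_const2)
      show "(\<lambda>m. proj_norm (X n - X m)) \<longlonglongrightarrow> lim (\<lambda>m. proj_norm (X n - X m))"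
        using X by (simp add: proj_cauchy_convergent_norm proj_cauchy_diff flip: convergent_LIMSEQ_iff)
      show "\<exists>M. \<forall>m\<ge>M. proj_norm (X n - X m) \<le> e / 2"
        using N[OF that] less_imp_le by blast
    qed
    finally show ?thesis using \<open>e > 0\<close> by simp
  qed
  then show "\<exists>N. \<forall>n\<ge>N. norm (ptensor_of (X n) - abs_ptensor X) < e" by blast
qed

lemma ptensor_of_dense:
  assumes "e > 0" shows "\<exists>u. norm (ptensor_of u - x) < e"
proof -
  obtain X where "proj_cauchy X" "x = abs_ptensor X" using ptensor_abs_exists by blast
  then show ?thesis
    using LIMSEQ_D[OF ptensor_tendsto assms] by blast
qed

instance ptensor :: (complex_normed_vector, complex_normed_vector) banach
proof
  fix x :: "nat \<Rightarrow> ('a, 'b) ptensor"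
  assume "Cauchy x"
  have "\<forall>n. \<exists>u. norm (ptensor_of u - x n) < inverse (real (Suc n))"
    by (intro allI ptensor_of_dense) simp
  then obtain U where U: "\<And>n. norm (ptensor_of (U n) - x n) < inverse (real (Suc n))"
    by metis
  have null: "(\<lambda>n. ptensor_of (U n) - x n) \<longlonglongrightarrow> 0"
    by (rule Lim_null_comparison[OF _ LIMSEQ_inverse_real_of_nat])
      (use U in \<open>auto intro: always_eventually less_imp_le\<close>)
  have "proj_cauchy U"
    unfolding proj_cauchy_def
  proof (intro allI impI)
    fix e :: real assume "e > 0"
    then have "e / 3 > 0" by simp
    obtain M where M: "\<And>m n. m \<ge> M \<Longrightarrow> n \<ge> M \<Longrightarrow> norm (x m - x n) < e / 3"
      using CauchyD[OF \<open>Cauchy x\<close> \<open>e / 3 > 0\<close>] by blast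
    obtain N where N: "\<And>n. n \<ge> N \<Longrightarrow> norm (ptensor_of (U n) - x n) < e / 3"
      using LIMSEQ_D[OF null \<open>e / 3 > 0\<close>] by auto
    have "proj_norm (U m - U n) < e" if "m \<ge> max M N" "n \<ge> max M N" for m n
    proof -
      have "proj_norm (U m - U n) = norm ((ptensor_of (U m) - x m) + (x m - x n) - (ptensor_of (U n) - x n))"
        by (simp add: ptensor_of_diff flip: norm_ptensor_of)
      also have "\<dots> \<le> norm (ptensor_of (U m) - x m) + norm (x m - x n) + norm (ptensor_of (U n) - x n)"
        by (intro order_trans[OF norm_triangle_ineq4] add_right_mono norm_triangle_ineq)
      also have "\<dots> < e" using M[of m n] N[of m] N[of n] that by simp
      finally show ?thesis .
    qed
    then show "\<exists>N. \<forall>m\<ge>N. \<forall>n\<ge>N. proj_norm (U m - U n) < e" by blast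
  qed
  from tendsto_diff[OF ptensor_tendsto[OF this] null]
  show "convergent x" by (auto simp: convergent_def)
qed

definition ptens :: "'a::complex_normed_vector \<Rightarrow> 'b::complex_normed_vector \<Rightarrow> ('a, 'b) ptensor" where
  "ptens a b = ptensor_of (tens a b)"

lemma ptensor_ext:
  fixes F G :: "('a::complex_normed_vector, 'b::complex_normed_vector) ptensor \<Rightarrow> 'c::complex_normed_vector"
  assumes F: "bounded_clinear F" and G: "bounded_clinear G"
    and eq: "\<And>a b. F (ptens a b) = G (ptens a b)"
  shows "F = G"
proof
  fix x :: "('a, 'b) ptensor"
  have lin: "H (x + y) = H x + H y" "H 0 = 0" if "bounded_clinear H" for H :: "('a, 'b) ptensor \<Rightarrow> 'c" and x y
    using that by (auto simp: bounded_clinear_def linear_add linear_0 bounded_linear.linear)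
  have z: "ptensor_of 0 = (0 :: ('a, 'b) ptensor)"
    using ptensor_of_add[of 0 0] by simp
  have "F (ptensor_of (tens_sum xs)) = G (ptensor_of (tens_sum xs))" for xs
    by (induction xs) (use eq in \<open>auto simp: z lin[OF F] lin[OF G] ptensor_of_add ptens_def\<close>)
  then have *: "F (ptensor_of u) = G (ptensor_of u)" for u
    using tensor_is_tens_sum[of u] by auto
  obtain X :: "nat \<Rightarrow> ('a, 'b) tensor" where X: "proj_cauchy X" "x = abs_ptensor X" using ptensor_abs_exists by blast
  have "(\<lambda>n. F (ptensor_of (X n))) \<longlonglongrightarrow> F x" "(\<lambda>n. G (ptensor_of (X n))) \<longlonglongrightarrow> G x"
    using F G ptensor_tendsto[OF X(1)] X(2)
    by (auto simp: bounded_clinear_def intro: bounded_linear.tendsto)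
  then show "F x = G x" using * LIMSEQ_unique by auto
qed

lemma ptensor_lift_exists:
  fixes B :: "'a::complex_normed_vector \<Rightarrow> 'b::complex_normed_vector \<Rightarrow> 'c::{complex_normed_vector, banach}"
  assumes "bounded_cbilinear B"
  shows "\<exists>F. bounded_clinear F \<and> (\<forall>a b. F (ptens a b) = B a b)"
proof -
  interpret bounded_bilinear B using assms by (simp add: bounded_cbilinear_def)
  obtain L where L: "\<And>u v. L (u + v) = L u + L v" "\<And>c u. L (c *\<^sub>C u) = c *\<^sub>C L u"
    "\<And>a b. L (tens a b) = B a b"
    using tensor_lift_exists[of B] assms add_left add_right unfolding bounded_cbilinear_def by metis
  obtain K where K: "K > 0" "\<And>a b. norm (B a b) \<le> norm a * norm b * K" using pos_bounded by blast
  have L0: "L 0 = 0" using L(1)[of 0 0] by simp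
  have Ldiff: "L (u - v) = L u - L v" for u v using L(1)[of "u - v" v] by simp
  have LK: "norm (L u) \<le> K * proj_norm u" for u
  proof -
    have "norm (L (tens_sum xs)) \<le> K * tens_cost xs" for xs
    proof (induction xs)
      case (Cons p xs)
      have "norm (L (tens_sum (p # xs))) \<le> norm (B (fst p) (snd p)) + norm (L (tens_sum xs))"
        by (simp add: L norm_triangle_ineq)
      also have "\<dots> \<le> K * tens_cost (p # xs)"
        using Cons K(2)[of "fst p" "snd p"] by (simp add: algebra_simps)
      finally show ?case .
    qed (simp add: L0)
    then have "norm (L u) / K \<le> proj_norm u"
      using K(1) by (intro proj_norm_greatest) (auto simp: divide_le_eq mult.commute)
    then show ?thesis using K(1) by (simp add: divide_le_eq mult.commute)
  qed
  define F where "F = (\<lambda>x. lim (\<lambda>n. L (rep_ptensor x n)))"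
  have conv: "convergent (\<lambda>n. L (X n))" if "proj_cauchy X" for X
  proof -
    have "Cauchy (\<lambda>n. L (X n))"
      unfolding Cauchy_def dist_norm
    proof (intro allI impI)
      fix e :: real assume "e > 0"
      then have "e / K > 0" using K by simp
      then obtain N where N: "\<And>m n. m \<ge> N \<Longrightarrow> n \<ge> N \<Longrightarrow> proj_norm (X m - X n) < e / K"
        using \<open>proj_cauchy X\<close> unfolding proj_cauchy_def by meson
      have "norm (L (X m) - L (X n)) < e" if "m \<ge> N" "n \<ge> N" for m n
        using N[OF that] LK[of "X m - X n"] K(1) by (simp add: Ldiff pos_less_divide_eq mult.commute)
      then show "\<exists>N. \<forall>m\<ge>N. \<forall>n\<ge>N. norm (L (X m) - L (X n)) < e" by blast
    qed
    then show ?thesis by (simp add: Cauchy_convergent_iff)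
  qed
  have F: "(\<lambda>n. L (X n)) \<longlonglongrightarrow> F (abs_ptensor X)" if X: "proj_cauchy X" for X
  proof -
    let ?Y = "rep_ptensor (abs_ptensor X)"
    have XY: "proj_equiv ?Y X"
      using Quotient3_rep_abs[OF Quotient3_ptensor] proj_equiv_refl[OF X] by blast
    then have Y: "(\<lambda>n. L (?Y n)) \<longlonglongrightarrow> F (abs_ptensor X)"
      unfolding F_def using conv[of ?Y] by (simp add: proj_equiv_def convergent_LIMSEQ_iff)
    have "(\<lambda>n. L (?Y n - X n)) \<longlonglongrightarrow> 0"
      by (rule Lim_null_comparison[of _ "\<lambda>n. K * proj_norm (?Y n - X n)"])
        (use XY LK tendsto_mult_right_zero in \<open>auto simp: proj_equiv_def\<close>)
    from tendsto_diff[OF Y this] show ?thesis by (simp add: Ldiff)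
  qed
  have F_of: "F (ptensor_of u) = L u" for u
    using F[of "\<lambda>_. u"] by (simp add: ptensor_of_def LIMSEQ_const_iff)
  have Fadd: "F (x + y) = F x + F y" for x y
  proof -
    obtain X Y where *: "proj_cauchy X" "x = abs_ptensor X" "proj_cauchy Y" "y = abs_ptensor Y"
      using ptensor_abs_exists by metis
    then have "x + y = abs_ptensor (\<lambda>n. X n + Y n)"
      by (simp add: plus_ptensor.abs_eq proj_equiv_refl)
    then have "(\<lambda>n. L (X n + Y n)) \<longlonglongrightarrow> F (x + y)"
      using F[OF proj_cauchy_add[OF *(1,3)]] by simp
    moreover have "(\<lambda>n. L (X n + Y n)) \<longlonglongrightarrow> F x + F y"
      using tendsto_add[OF F[OF *(1)] F[OF *(3)]] * by (simp add: L)
    ultimately show ?thesis using LIMSEQ_unique by blast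
  qed
  have Fscale: "F (c *\<^sub>C x) = c *\<^sub>C F x" for c x
  proof -
    obtain X where *: "proj_cauchy X" "x = abs_ptensor X"
      using ptensor_abs_exists by metis
    then have "c *\<^sub>C x = abs_ptensor (\<lambda>n. c *\<^sub>C X n)"
      by (simp add: scaleC_ptensor.abs_eq proj_equiv_refl)
    then have 1: "(\<lambda>n. L (c *\<^sub>C X n)) \<longlonglongrightarrow> F (c *\<^sub>C x)"
      using F[OF proj_cauchy_scaleC[OF *(1)]] by simp
    have "bounded_linear (\<lambda>v::'c. c *\<^sub>C v)"
      by (rule bounded_linear_intro[of _ "cmod c"])
        (simp_all add: scaleC_add_right scaleC_scaleC mult.commute norm_scaleC flip: scaleC_of_real)
    from bounded_linear.tendsto[OF this F[OF *(1)]] have "(\<lambda>n. L (c *\<^sub>C X n)) \<longlonglongrightarrow> c *\<^sub>C F x"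
      using * by (simp add: L)
    with 1 show ?thesis using LIMSEQ_unique by blast
  qed
  have Fbound: "norm (F x) \<le> norm x * K" for x
  proof -
    obtain X where *: "proj_cauchy X" "x = abs_ptensor X"
      using ptensor_abs_exists by metis
    have "(\<lambda>n. norm (ptensor_of (X n)) * K) \<longlonglongrightarrow> norm x * K"
      unfolding *(2) by (intro tendsto_intros ptensor_tendsto *)
    moreover have "(\<lambda>n. norm (L (X n))) \<longlonglongrightarrow> norm (F x)"
      unfolding *(2) by (intro tendsto_norm F *)
    ultimately show ?thesis
      using LK by (auto intro: LIMSEQ_le simp: mult.commute)
  qed
  have "bounded_linear F"
    by (rule bounded_linear_intro[of _ K])
      (simp_all add: Fadd Fscale Fbound flip: scaleC_of_real)
  then show ?thesis
    using Fscale F_of L(3) by (auto simp: bounded_clinear_def ptens_def)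
qed

text \<open>The description is proper for bounded bilinear \<open>B\<close> with values in a Banach space: see
  lemma \<open>ptensor_lift\<close> below.\<close>

definition ptensor_lift ::
  "('a::complex_normed_vector \<Rightarrow> 'b::complex_normed_vector \<Rightarrow> 'c::complex_normed_vector) \<Rightarrow>
   ('a, 'b) ptensor \<Rightarrow> 'c" where
  "ptensor_lift B = (THE F. bounded_clinear F \<and> (\<forall>a b. F (ptens a b) = B a b))"

lemma ptensor_lift:
  fixes B :: "'a::complex_normed_vector \<Rightarrow> 'b::complex_normed_vector \<Rightarrow> 'c::{complex_normed_vector, banach}"
  assumes "bounded_cbilinear B"
  shows "bounded_clinear (ptensor_lift B)" "ptensor_lift B (ptens a b) = B a b"
proof -
  have "\<exists>!F. bounded_clinear F \<and> (\<forall>a b. F (ptens a b) = B a b)"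
    using ptensor_lift_exists[OF assms] ptensor_ext by (metis (full_types))
  from theI'[OF this] show "bounded_clinear (ptensor_lift B)" "ptensor_lift B (ptens a b) = B a b"
    unfolding ptensor_lift_def by auto
qed

lemma ptens_bilinear:
  "ptens (a + a') b = ptens a b + ptens a' b" "ptens a (b + b') = ptens a b + ptens a b'"
  "ptens (c *\<^sub>C a) b = c *\<^sub>C ptens a b" "ptens a (c *\<^sub>C b) = c *\<^sub>C ptens a b"
  by (simp_all add: ptens_def tens_add_left tens_add_right tens_scaleC_left tens_scaleC_right
      ptensor_of_add ptensor_of_scaleC)

lemma norm_ptens_le: "norm (ptens a b) \<le> norm a * norm b"
  by (simp add: ptens_def proj_norm_tens)


subsection \<open>Module structure and multiplication map\<close>

definition tens_lact ::
  "'a::complex_banach_algebra \<Rightarrow> ('a, 'a) ptensor \<Rightarrow> ('a, 'a) ptensor" where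
  "tens_lact a = ptensor_lift (\<lambda>b c. ptens (a * b) c)"

definition tens_ract ::
  "('a::complex_banach_algebra, 'a) ptensor \<Rightarrow> 'a \<Rightarrow> ('a, 'a) ptensor" where
  "tens_ract x a = ptensor_lift (\<lambda>b c. ptens b (c * a)) x"

definition tens_mult :: "('a::complex_banach_algebra, 'a) ptensor \<Rightarrow> 'a" where
  "tens_mult = ptensor_lift (*)"

lemma bounded_cbilinearI:
  assumes "\<And>a a' b. B (a + a') b = B a b + B a' b" "\<And>a b b'. B a (b + b') = B a b + B a b'"
    "\<And>c a b. B (c *\<^sub>C a) b = c *\<^sub>C B a b" "\<And>c a b. B a (c *\<^sub>C b) = c *\<^sub>C B a b"
    "\<And>a b. norm (B a b) \<le> norm a * norm b * K"
  shows "bounded_cbilinear B"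
  unfolding bounded_cbilinear_def
  by (auto intro!: bounded_bilinear.intro exI[of _ K] simp: assms simp flip: scaleC_of_real)

lemma tens_lact:
  "bounded_clinear (tens_lact a)" "tens_lact a (ptens b c) = ptens (a * b) c"
proof -
  have "bounded_cbilinear (\<lambda>b c. ptens (a * b) c)"
  proof (rule bounded_cbilinearI[of _ "norm a"])
    show "norm (ptens (a * b) c) \<le> norm b * norm c * norm a" for b c
      using norm_ptens_le[of "a * b" c] mult_right_mono[OF norm_mult_ineq[of a b], of "norm c"]
      by (simp add: mult.commute mult.left_commute)
  qed (simp_all add: ptens_bilinear distrib_left scaleC_mult_right)
  from ptensor_lift[OF this]
  show "bounded_clinear (tens_lact a)" "tens_lact a (ptens b c) = ptens (a * b) c"
    by (simp_all add: tens_lact_def)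
qed

lemma tens_ract:
  "bounded_clinear (\<lambda>x. tens_ract x a)" "tens_ract (ptens b c) a = ptens b (c * a)"
proof -
  have "bounded_cbilinear (\<lambda>b c. ptens b (c * a))"
  proof (rule bounded_cbilinearI[of _ "norm a"])
    show "norm (ptens b (c * a)) \<le> norm b * norm c * norm a" for b c
      using norm_ptens_le[of b "c * a"] mult_left_mono[OF norm_mult_ineq[of c a], of "norm b"]
      by (simp add: mult.assoc)
  qed (simp_all add: ptens_bilinear distrib_right scaleC_mult_left)
  from ptensor_lift[OF this]
  show "bounded_clinear (\<lambda>x. tens_ract x a)" "tens_ract (ptens b c) a = ptens b (c * a)"
    by (simp_all add: tens_ract_def)
qed

lemma tens_mult:
  "bounded_clinear (tens_mult :: ('a::complex_banach_algebra, 'a) ptensor \<Rightarrow> 'a)"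
  "tens_mult (ptens b c) = b * (c::'a)"
proof -
  have "bounded_cbilinear ((*) :: 'a \<Rightarrow> 'a \<Rightarrow> 'a)"
    by (rule bounded_cbilinearI[of _ 1])
      (simp_all add: distrib_left distrib_right scaleC_mult_left scaleC_mult_right norm_mult_ineq)
  from ptensor_lift[OF this]
  show "bounded_clinear (tens_mult :: ('a, 'a) ptensor \<Rightarrow> 'a)" "tens_mult (ptens b c) = b * (c::'a)"
    by (simp_all add: tens_mult_def)
qed


section \<open>Dual modules, weak topologies and dual Banach algebras\<close>

text \<open>Module actions on the dual of a bimodule: \<open>(a \<cdot> f)(x) = f(x \<cdot> a)\<close> and \<open>(f \<cdot> a)(x) = f(a \<cdot> x)\<close>.
  Each of the two actions on the dual depends only on the opposite action \<open>r\<close> resp. \<open>l\<close> of the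
  original module. The dual of a submodule is treated in the same way.\<close>

definition dual_lact ::
  "('e::complex_normed_vector \<Rightarrow> 'a \<Rightarrow> 'e) \<Rightarrow> 'a \<Rightarrow> 'e cdual \<Rightarrow> 'e cdual" where
  "dual_lact r a f = cadjoint (\<lambda>x. r x a) f"

definition dual_ract ::
  "('a \<Rightarrow> 'e::complex_normed_vector \<Rightarrow> 'e) \<Rightarrow> 'e cdual \<Rightarrow> 'a \<Rightarrow> 'e cdual" where
  "dual_ract l f a = cadjoint (\<lambda>x. l a x) f"

definition subspace_dual_lact ::
  "'e set \<Rightarrow> ('e \<Rightarrow> 'a \<Rightarrow> 'e) \<Rightarrow> 'a \<Rightarrow> ('e \<Rightarrow> complex) \<Rightarrow> 'e \<Rightarrow> complex" where
  "subspace_dual_lact V r a \<phi> = (\<lambda>x\<in>V. \<phi> (r x a))"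

definition subspace_dual_ract ::
  "'e set \<Rightarrow> ('a \<Rightarrow> 'e \<Rightarrow> 'e) \<Rightarrow> ('e \<Rightarrow> complex) \<Rightarrow> 'a \<Rightarrow> 'e \<Rightarrow> complex" where
  "subspace_dual_ract V l \<phi> a = (\<lambda>x\<in>V. \<phi> (l a x))"

text \<open>The coarsest topology on \<open>S\<close> making all functions in \<open>\<Phi>\<close> continuous.\<close>

definition initial_topology :: "'x set \<Rightarrow> ('x \<Rightarrow> complex) set \<Rightarrow> 'x topology" where
  "initial_topology S \<Phi> =
     topology_generated_by (insert S {{x \<in> S. \<phi> x \<in> U} | \<phi> U. \<phi> \<in> \<Phi> \<and> open U})"

definition weak_topology :: "'e::complex_normed_vector topology" where
  "weak_topology = initial_topology UNIV (range capply)"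

text \<open>\<open>wkstar_topology V\<close> is the topology \<open>\<sigma>(V\<^sup>*, V)\<close> on the dual of \<open>V\<close>, whereas for \<open>P\<close> a
  subspace of the dual of \<open>'a\<close>, \<open>predual_topology P\<close> is the topology \<open>\<sigma>('a, P)\<close> on \<open>'a\<close>.\<close>

definition wkstar_topology :: "'e::complex_normed_vector set \<Rightarrow> ('e \<Rightarrow> complex) topology" where
  "wkstar_topology V = initial_topology (subspace_dual V) ((\<lambda>x \<phi>. \<phi> x) ` V)"

definition predual_topology :: "'a::complex_normed_vector cdual set \<Rightarrow> 'a topology" where
  "predual_topology P = initial_topology UNIV (capply ` P)"

definition predual_embedding ::
  "'a::complex_normed_vector cdual set \<Rightarrow> 'a \<Rightarrow> 'a cdual \<Rightarrow> complex" where
  "predual_embedding P a = (\<lambda>f\<in>P. capply f a)"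

text \<open>\<open>P\<close> is a predual: a closed submodule of the dual such that the canonical map
  \<open>'a \<rightarrow> P\<^sup>*\<close> is bijective. That map is bounded, hence it then is an isomorphism of Banach spaces by
  the open mapping theorem; it is not required to be isometric.\<close>

definition dual_banach_algebra :: "'a::complex_banach_algebra cdual set \<Rightarrow> bool" where
  "dual_banach_algebra P \<longleftrightarrow>
     closed P \<and> csubspace P \<and>
     (\<forall>a. \<forall>f\<in>P. dual_lact (*) a f \<in> P \<and> dual_ract (*) f a \<in> P) \<and>
     bij_betw (predual_embedding P) UNIV (subspace_dual P)"

text \<open>\<open>\<sigma>wc(E)\<close> for a bimodule \<open>E\<close> with left action \<open>l\<close> and right action \<open>r\<close>.\<close>

definition sigma_wc ::
  "'a::complex_banach_algebra cdual set \<Rightarrow> ('a \<Rightarrow> 'e \<Rightarrow> 'e) \<Rightarrow> ('e \<Rightarrow> 'a \<Rightarrow> 'e)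
    \<Rightarrow> 'e::complex_normed_vector set" where
  "sigma_wc P l r = {x.
     continuous_map (predual_topology P) weak_topology (\<lambda>a. l a x) \<and>
     continuous_map (predual_topology P) weak_topology (\<lambda>a. r x a)}"


section \<open>Connes amenability\<close>

abbreviation dtens_lact ::
  "'a::complex_banach_algebra \<Rightarrow> ('a, 'a) ptensor cdual \<Rightarrow> ('a, 'a) ptensor cdual" where
  "dtens_lact \<equiv> dual_lact tens_ract"

abbreviation dtens_ract ::
  "('a::complex_banach_algebra, 'a) ptensor cdual \<Rightarrow> 'a \<Rightarrow> ('a, 'a) ptensor cdual" where
  "dtens_ract \<equiv> dual_ract tens_lact"

definition swc_tens ::
  "'a::complex_banach_algebra cdual set \<Rightarrow> ('a, 'a) ptensor cdual set" where
  "swc_tens P = sigma_wc P dtens_lact dtens_ract"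

definition swc_lact ::
  "'a::complex_banach_algebra cdual set \<Rightarrow> 'a \<Rightarrow> (('a, 'a) ptensor cdual \<Rightarrow> complex)
    \<Rightarrow> ('a, 'a) ptensor cdual \<Rightarrow> complex" where
  "swc_lact P = subspace_dual_lact (swc_tens P) dtens_ract"

definition swc_ract ::
  "'a::complex_banach_algebra cdual set \<Rightarrow> (('a, 'a) ptensor cdual \<Rightarrow> complex) \<Rightarrow> 'a
    \<Rightarrow> ('a, 'a) ptensor cdual \<Rightarrow> complex" where
  "swc_ract P = subspace_dual_ract (swc_tens P) dtens_lact"

text \<open>The adjoint of the restriction of \<open>\<pi>\<^sup>*\<close> to the predual \<open>P\<close> takes values in the dual of \<open>P\<close>,
  which is identified with \<open>'a\<close> through \<open>predual_embedding P\<close>.\<close>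

definition pi_swc ::
  "'a::complex_banach_algebra cdual set \<Rightarrow> (('a, 'a) ptensor cdual \<Rightarrow> complex) \<Rightarrow> 'a" where
  "pi_swc P M = the_inv_into UNIV (predual_embedding P) (\<lambda>f\<in>P. M (cadjoint tens_mult f))"

definition connes_amenable :: "'a::complex_banach_algebra cdual set \<Rightarrow> bool" where
  "connes_amenable P \<longleftrightarrow>
     (\<exists>M \<in> subspace_dual (swc_tens P).
        \<forall>a. swc_lact P a M = swc_ract P M a \<and> a * pi_swc P M = a)"

definition directed_set :: "'i set \<Rightarrow> ('i \<Rightarrow> 'i \<Rightarrow> bool) \<Rightarrow> bool" where
  "directed_set I le \<longleftrightarrow> I \<noteq> {} \<and> (\<forall>i\<in>I. le i i) \<and>
     (\<forall>i\<in>I. \<forall>j\<in>I. \<forall>k\<in>I. le i j \<longrightarrow> le j k \<longrightarrow> le i k) \<and>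
     (\<forall>i\<in>I. \<forall>j\<in>I. \<exists>k\<in>I. le i k \<and> le j k)"

definition net_filter :: "'i set \<Rightarrow> ('i \<Rightarrow> 'i \<Rightarrow> bool) \<Rightarrow> 'i filter" where
  "net_filter I le = (INF i\<in>I. principal {j \<in> I. le i j})"

definition strong_pseudo_connes_net ::
  "'a::complex_banach_algebra cdual set \<Rightarrow> 'i set \<Rightarrow> ('i \<Rightarrow> 'i \<Rightarrow> bool)
    \<Rightarrow> ('i \<Rightarrow> ('a, 'a) ptensor cdual \<Rightarrow> complex) \<Rightarrow> bool" where
  "strong_pseudo_connes_net P I le m \<longleftrightarrow>
     directed_set I le \<and> (\<forall>i\<in>I. m i \<in> subspace_dual (swc_tens P)) \<and>
     (\<forall>a.
        limitin (wkstar_topology (swc_tens P))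
          (\<lambda>i. \<lambda>f\<in>swc_tens P. swc_lact P a (m i) f - swc_ract P (m i) a f)
          (\<lambda>f\<in>swc_tens P. 0) (net_filter I le) \<and>
        (\<forall>i\<in>I. a * pi_swc P (m i) = pi_swc P (m i) * a) \<and>
        limitin (predual_topology P) (\<lambda>i. a * pi_swc P (m i)) a (net_filter I le))"

text \<open>HOL cannot quantify over the type of the index set inside a formula. Index sets in the type
  \<open>X \<times> X set\<close>, where \<open>X\<close> is the type of the values of the net, give the full generality: see
  \<open>strong_pseudo_connes_amenableI\<close> below.\<close>

definition strong_pseudo_connes_amenable :: "'a::complex_banach_algebra cdual set \<Rightarrow> bool" where
  "strong_pseudo_connes_amenable P \<longleftrightarrow>
     (\<exists>(I :: ((('a, 'a) ptensor cdual \<Rightarrow> complex) \<times> (('a, 'a) ptensor cdual \<Rightarrow> complex) set) set) le m.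
        strong_pseudo_connes_net P I le m)"

lemma eventually_net_filter:
  assumes "directed_set I le"
  shows "eventually Q (net_filter I le) \<longleftrightarrow> (\<exists>i\<in>I. \<forall>j\<in>I. le i j \<longrightarrow> Q j)"
  unfolding net_filter_def
proof (subst eventually_INF_base)
  show "I \<noteq> {}" using assms by (simp add: directed_set_def)
  fix a b assume "a \<in> I" "b \<in> I"
  then obtain k where "k \<in> I" "le a k" "le b k" using assms unfolding directed_set_def by blast
  moreover from this have "{j \<in> I. le k j} \<subseteq> {j \<in> I. le a j} \<inter> {j \<in> I. le b j}"
    using assms \<open>a \<in> I\<close> \<open>b \<in> I\<close> unfolding directed_set_def by blast
  ultimately show "\<exists>x\<in>I. principal {j \<in> I. le x j} \<le> inf (principal {j \<in> I. le a j}) (principal {j \<in> I. le b j})"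
    by (auto simp: inf_principal)
next
  show "(\<exists>x\<in>I. eventually Q (principal {j \<in> I. le x j})) \<longleftrightarrow> (\<exists>i\<in>I. \<forall>j\<in>I. le i j \<longrightarrow> Q j)"
    by (auto simp: eventually_principal)
qed

lemma strong_pseudo_connes_amenableI:
  fixes P :: "'a::complex_banach_algebra cdual set" and I :: "'i set"
  assumes net: "strong_pseudo_connes_net P I le m"
  shows "strong_pseudo_connes_amenable P"
proof -
  define tail where "tail = (\<lambda>i. m ` {j \<in> I. le i j})"
  define J where "J = {(x, S). S \<in> tail ` I \<and> x \<in> S}"
  define le' where "le' = (\<lambda>(p :: (('a, 'a) ptensor cdual \<Rightarrow> complex) \<times> (('a, 'a) ptensor cdual \<Rightarrow> complex) set) (q :: (('a, 'a) ptensor cdual \<Rightarrow> complex) \<times> (('a, 'a) ptensor cdual \<Rightarrow> complex) set). snd q \<subseteq> snd p)"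
  have dir: "directed_set I le" using net by (simp add: strong_pseudo_connes_net_def)
  have tail_mono: "tail k \<subseteq> tail i" if "i \<in> I" "k \<in> I" "le i k" for i k
    using that dir unfolding tail_def directed_set_def by blast
  have in_tail: "m i \<in> tail i" if "i \<in> I" for i
    using that dir unfolding tail_def directed_set_def by blast
  have dir': "directed_set J le'"
    unfolding directed_set_def
  proof (intro conjI ballI impI)
    show "J \<noteq> {}"
      using dir in_tail unfolding J_def directed_set_def by blast
    fix p q assume "p \<in> J" "q \<in> J"
    then obtain i j where ij: "i \<in> I" "j \<in> I" "snd p = tail i" "snd q = tail j"
      by (auto simp: J_def)
    then obtain k where "k \<in> I" "le i k" "le j k" using dir unfolding directed_set_def by blast
    with ij show "\<exists>r\<in>J. le' p r \<and> le' q r"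
      using tail_mono[of i k] tail_mono[of j k] in_tail[of k]
      by (intro bexI[of _ "(m k, tail k)"]) (auto simp: J_def le'_def)
  qed (auto simp: le'_def)
  have ev: "eventually (\<lambda>p. Q (fst p)) (net_filter J le')" if Q: "eventually (\<lambda>i. Q (m i)) (net_filter I le)" for Q
  proof -
    obtain i where i: "i \<in> I" "\<And>j. j \<in> I \<Longrightarrow> le i j \<Longrightarrow> Q (m j)"
      using Q unfolding eventually_net_filter[OF dir] by blast
    have "Q (fst p)" if "p \<in> J" "le' (m i, tail i) p" for p
    proof -
      have "fst p \<in> tail i" using that by (auto simp: J_def le'_def)
      then show ?thesis using i by (auto simp: tail_def)
    qed
    with in_tail[OF i(1)] i(1) show ?thesis
      unfolding eventually_net_filter[OF dir'] by (intro bexI[of _ "(m i, tail i)"]) (auto simp: J_def)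
  qed
  have lim: "limitin T (\<lambda>p. g (fst p)) l (net_filter J le')"
    if "limitin T (\<lambda>i. g (m i)) l (net_filter I le)" for T g and l :: 'z
    using that unfolding limitin_def using ev[of "\<lambda>x. g x \<in> _"] by simp
  have range: "\<exists>i\<in>I. fst p = m i" if "p \<in> J" for p
    using that by (auto simp: J_def tail_def)
  have mem: "m i \<in> subspace_dual (swc_tens P)" "a * pi_swc P (m i) = pi_swc P (m i) * a"
    if "i \<in> I" for i a
    using net that by (simp_all add: strong_pseudo_connes_net_def)
  have "strong_pseudo_connes_net P J le' fst"
    unfolding strong_pseudo_connes_net_def
  proof (intro conjI allI ballI)
    fix a
    show "limitin (wkstar_topology (swc_tens P))
        (\<lambda>p. \<lambda>f\<in>swc_tens P. swc_lact P a (fst p) f - swc_ract P (fst p) a f)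
        (\<lambda>f\<in>swc_tens P. 0) (net_filter J le')"
      using net unfolding strong_pseudo_connes_net_def
      by (intro lim[of _ "\<lambda>x. \<lambda>f\<in>swc_tens P. swc_lact P a x f - swc_ract P x a f"]) blast
    show "limitin (predual_topology P) (\<lambda>p. a * pi_swc P (fst p)) a (net_filter J le')"
      using net unfolding strong_pseudo_connes_net_def
      by (intro lim[of _ "\<lambda>x. a * pi_swc P x"]) blast
    fix p assume "p \<in> J"
    then obtain i where "i \<in> I" "fst p = m i" using range by blast
    then show "fst p \<in> subspace_dual (swc_tens P)" "a * pi_swc P (fst p) = pi_swc P (fst p) * a"
      using mem by simp_all
  qed (rule dir')
  then show ?thesis unfolding strong_pseudo_connes_amenable_def by blast
qed

end

theory Submission
  imports Defs
begin

text \<open>A \<open>\<sigma>wc\<close>-virtual diagonal \<open>M\<close>, regarded as a net with a single index, is the required net.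
  As \<open>a \<cdot> M = M \<cdot> a\<close> and \<open>a \<pi>(M) = a\<close>, both limits are limits of constants, and the substance is that
  \<open>\<pi>(M)\<close> commutes with every \<open>a\<close>. This holds because \<open>\<pi>\<^sub>\<sigma>\<^sub>w\<^sub>c\<close> is a bimodule morphism, which gives
  \<open>a \<pi>(M) = \<pi>(a \<cdot> M) = \<pi>(M \<cdot> a) = \<pi>(M) a\<close>.

  The equation \<open>\<langle>f, \<pi>(M)\<rangle> = \<langle>M, \<pi>\<^sup>* f\<rangle>\<close> for \<open>f\<close> in the predual \<open>P\<close>, on which everything rests,
  is meaningful only if \<open>\<pi>\<^sup>*\<close> maps \<open>P\<close> into \<open>\<sigma>wc((A \<otimes> A)\<^sup>*)\<close>
  (lemma \<open>cadjoint_tens_mult_mem_swc_tens\<close>): the value of \<open>M\<close> outside this subspace is a default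
  value. The inclusion follows from the predual: for a bounded functional \<open>\<Psi>\<close> on \<open>(A \<otimes> A)\<^sup>*\<close>, the
  functional \<open>\<Psi> \<circ> \<pi>\<^sup>*\<close> agrees on \<open>P\<close> with the evaluation at some \<open>b\<close> in \<open>A\<close>. Hence
  \<open>\<Psi>(a \<cdot> \<pi>\<^sup>* f) = \<Psi>(\<pi>\<^sup>*(a \<cdot> f)) = (a \<cdot> f)(b) = f (b a) = (f \<cdot> b)(a)\<close>, and \<open>f \<cdot> b\<close> belongs to \<open>P\<close>, so
  this expression is \<open>\<sigma>(A, P)\<close>-continuous in \<open>a\<close>. The right action is symmetric.\<close>


section \<open>Initial topologies\<close>

lemma topspace_initial_topology [simp]: "topspace (initial_topology S \<Phi>) = S"
  by (auto simp: initial_topology_def)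

lemma continuous_map_initial_topology_member:
  assumes "\<phi> \<in> \<Phi>"
  shows "continuous_map (initial_topology S \<Phi>) euclidean \<phi>"
  unfolding continuous_map_def
proof (intro conjI allI impI)
  fix U :: "complex set" assume "openin euclidean U"
  then show "openin (initial_topology S \<Phi>) {x \<in> topspace (initial_topology S \<Phi>). \<phi> x \<in> U}"
    unfolding topspace_initial_topology
    unfolding initial_topology_def
    by (intro topology_generated_by_Basis) (use assms in auto)
qed simp

lemma continuous_map_into_initial_topology_iff:
  "continuous_map X (initial_topology S \<Phi>) f \<longleftrightarrow>
     f ` topspace X \<subseteq> S \<and> (\<forall>\<phi>\<in>\<Phi>. continuous_map X euclidean (\<lambda>x. \<phi> (f x)))"
proof (intro iffI conjI ballI)
  assume f: "continuous_map X (initial_topology S \<Phi>) f"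
  then show "f ` topspace X \<subseteq> S"
    using continuous_map_image_subset_topspace by fastforce
  fix \<phi> assume "\<phi> \<in> \<Phi>"
  from continuous_map_compose[OF f continuous_map_initial_topology_member[OF this]]
  show "continuous_map X euclidean (\<lambda>x. \<phi> (f x))" by (simp add: o_def)
next
  assume f: "f ` topspace X \<subseteq> S \<and> (\<forall>\<phi>\<in>\<Phi>. continuous_map X euclidean (\<lambda>x. \<phi> (f x)))"
  show "continuous_map X (initial_topology S \<Phi>) f"
    unfolding initial_topology_def
  proof (rule continuous_on_generated_topo)
    show "f ` topspace X \<subseteq> \<Union> (insert S {{x \<in> S. \<phi> x \<in> U} |\<phi> U. \<phi> \<in> \<Phi> \<and> open U})"
      using f by auto
    fix V assume "V \<in> insert S {{x \<in> S. \<phi> x \<in> U} |\<phi> U. \<phi> \<in> \<Phi> \<and> open U}"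
    then consider "V = S" | \<phi> U where "V = {x \<in> S. \<phi> x \<in> U}" "\<phi> \<in> \<Phi>" "open U" by auto
    then show "openin X (f -` V \<inter> topspace X)"
    proof cases
      case 1
      with f have "f -` V \<inter> topspace X = topspace X" by auto
      then show ?thesis by simp
    next
      case 2
      with f have "f -` V \<inter> topspace X = {x \<in> topspace X. \<phi> (f x) \<in> U}" by auto
      with 2 f show ?thesis by (auto simp: continuous_map_def)
    qed
  qed
qed

corollary continuous_map_into_weak_topology_iff:
  "continuous_map X weak_topology f \<longleftrightarrow> (\<forall>\<Psi>. continuous_map X euclidean (\<lambda>x. capply \<Psi> (f x)))"
  unfolding weak_topology_def continuous_map_into_initial_topology_iff by simp

lemma continuous_map_predual_topology_capply:
  "f \<in> P \<Longrightarrow> continuous_map (predual_topology P) euclidean (capply f)"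
  unfolding predual_topology_def by (rule continuous_map_initial_topology_member) simp


lemma continuous_map_cmult:
  fixes f :: "'x \<Rightarrow> complex"
  assumes "continuous_map X euclidean f"
  shows "continuous_map X euclidean (\<lambda>x. c * f x)"
  using assms by (simp add: continuous_map_atin tendsto_mult_left)


section \<open>Functionals, adjoints and dual actions\<close>

lemma capply_arg [simp]:
  "capply f (x + y) = capply f x + capply f y"
  "capply f (c *\<^sub>C x) = c * capply f x"
  "capply f 0 = 0"
  using bounded_clinear_capply[of f]
  by (auto simp: bounded_clinear_def scaleC_complex_def linear_simps)

lemma norm_capply_le: "cmod (capply f x) \<le> norm f * norm x"
  unfolding norm_cdual_eq_onorm
  by (rule onorm) (use bounded_clinear_capply in \<open>auto simp: bounded_clinear_def\<close>)

lemma bounded_clinear_cadjoint: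
  assumes T: "bounded_clinear T"
  shows "bounded_clinear (cadjoint T)"
proof -
  have scale: "cadjoint T (c *\<^sub>C f) = c *\<^sub>C cadjoint T f" for c f
    by (rule cdual_eqI) (simp add: capply_cadjoint[OF T])
  have "norm (cadjoint T f) \<le> norm f * onorm T" for f
    unfolding norm_cdual_eq_onorm[of "cadjoint T f"]
  proof (rule onorm_bound)
    have bl: "bounded_linear T" using T by (simp add: bounded_clinear_def)
    then show "0 \<le> norm f * onorm T" by (simp add: onorm_pos_le)
    fix x
    have "cmod (capply f (T x)) \<le> norm f * norm (T x)" by (rule norm_capply_le)
    also have "\<dots> \<le> norm f * (onorm T * norm x)"
      by (intro mult_left_mono onorm bl norm_ge_zero)
    finally show "cmod (capply (cadjoint T f) x) \<le> norm f * onorm T * norm x"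
      by (simp add: capply_cadjoint[OF T] mult.assoc)
  qed
  moreover have "cadjoint T (f + g) = cadjoint T f + cadjoint T g" for f g
    by (rule cdual_eqI) (simp add: capply_cadjoint[OF T])
  moreover have "cadjoint T (r *\<^sub>R f) = r *\<^sub>R cadjoint T f" for r f
    using scale[of "of_real r" f] by (simp add: scaleC_of_real)
  ultimately show ?thesis
    unfolding bounded_clinear_def using scale
    by (auto intro!: bounded_linear_intro[of _ "onorm T"])
qed

lemma cadjoint_simps:
  assumes "bounded_clinear T"
  shows "cadjoint T (f + g) = cadjoint T f + cadjoint T g"
    and "cadjoint T (c *\<^sub>C f) = c *\<^sub>C cadjoint T f"
    and "cadjoint T 0 = 0"
  using bounded_clinear_cadjoint[OF assms] by (auto simp: bounded_clinear_def linear_simps)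

lemma bounded_clinear_mult:
  "bounded_clinear (\<lambda>x::'a::complex_banach_algebra. a * x)"
  "bounded_clinear (\<lambda>x::'a::complex_banach_algebra. x * a)"
  by (auto simp: bounded_clinear_def bounded_linear_mult_left bounded_linear_mult_right
      scaleC_mult_left scaleC_mult_right)

lemma capply_dual_act_mult:
  fixes f :: "'a::complex_banach_algebra cdual"
  shows "capply (dual_lact (*) a f) x = capply f (x * a)"
    and "capply (dual_ract (*) f a) x = capply f (a * x)"
  by (simp_all add: dual_lact_def dual_ract_def capply_cadjoint bounded_clinear_mult)

lemma tens_mult_module_map:
  fixes x :: "('a::complex_banach_algebra, 'a) ptensor"
  shows "tens_mult (tens_lact a x) = a * tens_mult x"
    and "tens_mult (tens_ract x a) = tens_mult x * a"
proof -
  have comp: "bounded_clinear (\<lambda>x. F (G x))" if "bounded_clinear F" "bounded_clinear G"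
    for F :: "'y::complex_normed_vector \<Rightarrow> 'z::complex_normed_vector"
      and G :: "'x::complex_normed_vector \<Rightarrow> 'y"
    using that by (auto simp: bounded_clinear_def intro: bounded_linear_compose)
  show "tens_mult (tens_lact a x) = a * tens_mult x"
    by (rule fun_cong[OF ptensor_ext[where F = "\<lambda>x. tens_mult (tens_lact a x)"
            and G = "\<lambda>x. a * tens_mult x"]])
      (simp_all add: comp tens_lact tens_mult bounded_clinear_mult mult.assoc)
  show "tens_mult (tens_ract x a) = tens_mult x * a"
    by (rule fun_cong[OF ptensor_ext[where F = "\<lambda>x. tens_mult (tens_ract x a)"
            and G = "\<lambda>x. tens_mult x * a"]])
      (simp_all add: comp[OF _ tens_ract(1)] comp[OF bounded_clinear_mult(2)]
        tens_ract tens_mult mult.assoc)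
qed

lemma cadjoint_tens_mult_module_map:
  fixes f :: "'a::complex_banach_algebra cdual"
  shows "dtens_lact a (cadjoint tens_mult f) = cadjoint tens_mult (dual_lact (*) a f)"
    and "dtens_ract (cadjoint tens_mult f) a = cadjoint tens_mult (dual_ract (*) f a)"
  by (auto intro!: cdual_eqI simp: dual_lact_def dual_ract_def capply_cadjoint tens_mult
      tens_lact tens_ract bounded_clinear_mult tens_mult_module_map)


section \<open>The space \<open>\<sigma>wc((A \<otimes> A)\<^sup>*)\<close>\<close>

text \<open>Functionals on a subspace are undefined outside it, so even the zero functional, which is the
  limit of the net, is additive only because \<open>\<sigma>wc((A \<otimes> A)\<^sup>*)\<close> is closed under sums.\<close>

lemma csubspace_swc_tens: "csubspace (swc_tens P)"
  unfolding csubspace_def swc_tens_def sigma_wc_def continuous_map_into_weak_topology_iff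
  by (auto simp: dual_lact_def dual_ract_def cadjoint_simps tens_lact tens_ract
      intro!: continuous_map_add continuous_map_cmult)

lemma zero_in_subspace_dual:
  assumes "csubspace V"
  shows "(\<lambda>x\<in>V. 0) \<in> subspace_dual V"
  using assms by (auto simp: subspace_dual_def csubspace_def intro!: exI[of _ 0])

text \<open>Surjectivity of the canonical map from \<open>A\<close> to the dual of \<open>P\<close> turns bounded functionals on
  \<open>P\<close> into points of \<open>A\<close>.\<close>

lemma dual_banach_algebra_representing_element:
  assumes "dual_banach_algebra P" "\<phi> \<in> subspace_dual P"
  shows "\<exists>b. \<forall>f\<in>P. capply f b = \<phi> f"
proof -
  obtain b where "\<phi> = predual_embedding P b"
    using assms unfolding dual_banach_algebra_def bij_betw_def by blast
  then show ?thesis by (auto simp: predual_embedding_def)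
qed

lemma capply_cadjoint_in_subspace_dual:
  assumes T: "bounded_clinear T" and P: "csubspace P"
  shows "(\<lambda>f\<in>P. capply \<Psi> (cadjoint T f)) \<in> subspace_dual P"
proof -
  have "bounded_linear (\<lambda>f. capply \<Psi> (cadjoint T f))"
    using bounded_clinear_cadjoint[OF T] bounded_clinear_capply[of \<Psi>]
    by (auto simp: bounded_clinear_def intro: bounded_linear_compose)
  then obtain K where "\<And>f. cmod (capply \<Psi> (cadjoint T f)) \<le> norm f * K"
    using bounded_linear.bounded by blast
  then show ?thesis
    using P by (auto simp: subspace_dual_def csubspace_def cadjoint_simps[OF T] mult.commute)
qed

lemma cadjoint_tens_mult_mem_swc_tens:
  assumes P: "dual_banach_algebra P" and f: "f \<in> P"
  shows "cadjoint tens_mult f \<in> swc_tens P"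
proof -
  have act: "dual_lact (*) a f \<in> P" "dual_ract (*) f a \<in> P" for a
    using P f by (auto simp: dual_banach_algebra_def)
  have "csubspace P" using P by (simp add: dual_banach_algebra_def)
  note rep = dual_banach_algebra_representing_element[OF P
      capply_cadjoint_in_subspace_dual[OF tens_mult(1) this]]
  have "continuous_map (predual_topology P) euclidean
        (\<lambda>a. capply \<Psi> (dtens_lact a (cadjoint tens_mult f))) \<and>
      continuous_map (predual_topology P) euclidean
        (\<lambda>a. capply \<Psi> (dtens_ract (cadjoint tens_mult f) a))" for \<Psi>
  proof -
    obtain b where b: "\<And>g. g \<in> P \<Longrightarrow> capply \<Psi> (cadjoint tens_mult g) = capply g b"
      using rep[of \<Psi>] by (auto simp: eq_commute)
    have "(\<lambda>a. capply \<Psi> (dtens_lact a (cadjoint tens_mult f))) = capply (dual_ract (*) f b)"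
      "(\<lambda>a. capply \<Psi> (dtens_ract (cadjoint tens_mult f) a)) = capply (dual_lact (*) b f)"
      by (auto simp: cadjoint_tens_mult_module_map b act capply_dual_act_mult)
    then show ?thesis
      by (simp add: continuous_map_predual_topology_capply act)
  qed
  then show ?thesis
    by (simp add: swc_tens_def sigma_wc_def continuous_map_into_weak_topology_iff)
qed


section \<open>The morphism \<open>\<pi>\<^sub>\<sigma>\<^sub>w\<^sub>c\<close>\<close>

text \<open>The inverse of the canonical embedding yields a preimage only of an element of the dual of \<open>P\<close>;
  thus the linearity and the boundedness of \<open>M \<circ> \<pi>\<^sup>*\<close> on \<open>P\<close> have to be checked.\<close>

lemma capply_pi_swc:
  fixes P :: "'a::complex_banach_algebra cdual set"
  assumes P: "dual_banach_algebra P" and M: "M \<in> subspace_dual (swc_tens P)" and f: "f \<in> P"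
  shows "capply f (pi_swc P M) = M (cadjoint tens_mult f)"
proof -
  let ?\<phi> = "\<lambda>g\<in>P. M (cadjoint tens_mult g)"
  have sub: "csubspace P" and bij: "bij_betw (predual_embedding P) UNIV (subspace_dual P)"
    using P by (auto simp: dual_banach_algebra_def)
  obtain K where K: "\<And>x. x \<in> swc_tens P \<Longrightarrow> cmod (M x) \<le> K * norm x"
    using M unfolding subspace_dual_def by blast
  have bl: "bounded_linear (cadjoint (tens_mult :: ('a, 'a) ptensor \<Rightarrow> 'a))"
    by (rule bounded_clinear_cadjoint[OF tens_mult(1), unfolded bounded_clinear_def, THEN conjunct1])
  have bound: "cmod (M (cadjoint tens_mult g))
      \<le> \<bar>K\<bar> * onorm (cadjoint (tens_mult :: ('a, 'a) ptensor \<Rightarrow> 'a)) * norm g" if "g \<in> P" for g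
  proof -
    have "cmod (M (cadjoint tens_mult g)) \<le> K * norm (cadjoint tens_mult g)"
      by (rule K[OF cadjoint_tens_mult_mem_swc_tens[OF P that]])
    also have "\<dots> \<le> \<bar>K\<bar> * norm (cadjoint tens_mult g)" by (simp add: mult_right_mono)
    also have "\<dots> \<le> \<bar>K\<bar> * (onorm (cadjoint (tens_mult :: ('a, 'a) ptensor \<Rightarrow> 'a)) * norm g)"
      by (intro mult_left_mono onorm[OF bl]) simp
    finally show ?thesis by (simp add: mult.assoc)
  qed
  then have "?\<phi> \<in> subspace_dual P"
    using M sub cadjoint_tens_mult_mem_swc_tens[OF P]
    by (auto simp: subspace_dual_def csubspace_def cadjoint_simps[OF tens_mult(1)])
  with bij have "predual_embedding P (pi_swc P M) = ?\<phi>"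
    unfolding pi_swc_def bij_betw_def by (metis f_the_inv_into_f)
  from fun_cong[OF this, of f] f show ?thesis by (simp add: predual_embedding_def)
qed

text \<open>This is the bimodule morphism property of \<open>\<pi>\<^sub>\<sigma>\<^sub>w\<^sub>c\<close>, tested against the predual: moving \<open>a\<close> from
  the argument of \<open>f\<close> to \<open>f\<close> stays inside \<open>P\<close>, where \<open>\<pi>\<^sup>*\<close> intertwines the actions.\<close>

lemma capply_mult_pi_swc:
  assumes P: "dual_banach_algebra P" and M: "M \<in> subspace_dual (swc_tens P)" and f: "f \<in> P"
  shows "capply f (a * pi_swc P M) = swc_lact P a M (cadjoint tens_mult f)"
    and "capply f (pi_swc P M * a) = swc_ract P M a (cadjoint tens_mult f)"
proof -
  have act: "dual_lact (*) a f \<in> P" "dual_ract (*) f a \<in> P"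
    using P f by (auto simp: dual_banach_algebra_def)
  show "capply f (a * pi_swc P M) = swc_lact P a M (cadjoint tens_mult f)"
    using capply_pi_swc[OF P M act(2)] cadjoint_tens_mult_mem_swc_tens[OF P f]
    by (simp add: swc_lact_def subspace_dual_lact_def cadjoint_tens_mult_module_map
        capply_dual_act_mult)
  show "capply f (pi_swc P M * a) = swc_ract P M a (cadjoint tens_mult f)"
    using capply_pi_swc[OF P M act(1)] cadjoint_tens_mult_mem_swc_tens[OF P f]
    by (simp add: swc_ract_def subspace_dual_ract_def cadjoint_tens_mult_module_map
        capply_dual_act_mult)
qed

lemma pi_swc_commute:
  assumes P: "dual_banach_algebra P" and M: "M \<in> subspace_dual (swc_tens P)"
    and eq: "swc_lact P a M = swc_ract P M a"
  shows "a * pi_swc P M = pi_swc P M * a"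
proof -
  \<comment> \<open>The predual separates the points of \<open>A\<close>.\<close>
  have "predual_embedding P (a * pi_swc P M) = predual_embedding P (pi_swc P M * a)"
    unfolding predual_embedding_def
    by (rule restrict_ext) (simp add: capply_mult_pi_swc[OF P M] eq)
  then show ?thesis
    using P by (auto simp: dual_banach_algebra_def bij_betw_def dest: injD)
qed


section \<open>Connes amenability implies strong pseudo-Connes amenability\<close>

theorem proposition2p5:
  fixes P :: "'a::complex_banach_algebra cdual set"
  assumes "dual_banach_algebra P"
    and "connes_amenable P"
  shows "strong_pseudo_connes_amenable P"
proof -
  obtain M where M: "M \<in> subspace_dual (swc_tens P)"
    and eq: "\<And>a. swc_lact P a M = swc_ract P M a" and unit: "\<And>a. a * pi_swc P M = a"
    using assms(2) by (auto simp: connes_amenable_def)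
  have "strong_pseudo_connes_net P {()} (\<lambda>_ _. True) (\<lambda>_. M)"
    unfolding strong_pseudo_connes_net_def
  proof (intro conjI allI ballI)
    show "directed_set {()} (\<lambda>_ _. True)" by (simp add: directed_set_def)
    show "M \<in> subspace_dual (swc_tens P)" by (rule M)
    fix a
    show "limitin (wkstar_topology (swc_tens P))
        (\<lambda>i. \<lambda>f\<in>swc_tens P. swc_lact P a M f - swc_ract P M a f)
        (\<lambda>f\<in>swc_tens P. 0) (net_filter {()} (\<lambda>_ _. True))"
      by (simp add: eq wkstar_topology_def zero_in_subspace_dual csubspace_swc_tens)
    show "a * pi_swc P M = pi_swc P M * a"
      by (rule pi_swc_commute[OF assms(1) M eq])
    show "limitin (predual_topology P) (\<lambda>i. a * pi_swc P M) a (net_filter {()} (\<lambda>_ _. True))"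
      by (simp add: unit predual_topology_def)
  qed
  then show ?thesis by (rule strong_pseudo_connes_amenableI)
qed

end
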